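(* Consider the algorithm DIST-OPT described in the context, run with the linear voltage model $v(p,q)=Rp+Xq+v_0\mathbf 1$. Assume Problem (P) satisfies Slater's condition: there exist $p,q\in\mathbb R^N$ with $\underline p<p<\bar p$, $\underline q<q<\bar q$ and $\underline v<v(p,q)<\bar v$ (all inequalities componentwise and strict). Assume all communication delays are bounded by $\tau_{\max}\in\mathbb Z_{\ge 0}$, and let the step size satisfy $$0<\gamma<\frac{2}{\bigl(1+((\tau_{\max}+1)d+1)\sqrt N\bigr)L},\qquad L=\frac{2(\|R\|^2+\|X\|^2)}{a_{\min}}.$$ Then $\lim_{t\to\infty}(p(t),q(t))=(p^\star,q^\star)$, where $(p^\star,q^\star)$ is the (unique) optimal solution of Problem (P).
   Context: Network: a radial network is a tree on nodes $\{0,1,\dots,N\}$ rooted at node $0$; $\mathcal N=\{1,\dots,N\}$. Each $i\in\mathcal N$ has a unique parent $\sigma_i\in\{0,\dots,N\}$. Each edge $(h,k)$ ($h$ the parent of $k$) has resistance $r_{hk}\ge0$ and reactance $x_{hk}\ge0$. $\mathcal P_i$ is the set of edges on the path from $0$ to $i$. Define $N\times N$ matrices $R_{ij}=2\sum_{(h,k)\in\mathcal P_i\cap\mathcal P_j}r_{hk}$ and $X_{ij}=2\sum_{(h,k)\in\mathcal P_i\cap\mathcal P_j}x_{hk}$. $\texttt{dist}(i,j)$ is the number of edges on the tree path between $i$ and $j$, and $d=\max_{i,j\in\mathcal N}\texttt{dist}(i,j)$. Voltage model: $v(p,q)=Rp+Xq+v_0\mathbf 1\in\mathbb R^N$ for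 a fixed $v_0\in\mathbb R$. $\|\cdot\|$ is the Euclidean norm on vectors and the spectral norm on matrices. Problem (P): given vectors $\underline v\le\bar v$, $\underline p\le\bar p$, $\underline q\le\bar q$ in $\mathbb R^N$ and reals $a_i^{P},a_i^{Q}>0$, $b_i^P,b_i^Q,c_i^P,c_i^Q$, minimize over $p,q\in\mathbb R^N$ the cost $\sum_{i=1}^N(\tfrac{a_i^P}{2}p_i^2+b_i^Pp_i+c_i^P)+\sum_{i=1}^N(\tfrac{a_i^Q}{2}q_i^2+b_i^Qq_i+c_i^Q)$ subject to $\underline v\le v(p,q)\le\bar v$, $\underline p\le p\le\bar p$, $\underline q\le q\le\bar q$. Let $a_{\min}=\min\{a_1^P,\dots,a_N^P,a_1^Q,\dots,a_N^Q\}$. Algorithm DIST-OPT. For $i\in\mathcal N$, the algorithmic parent of $i$ is $\sigma_i$ if $\sigma_i\neq0$; if $\sigma_i=0$, $i$ has no algorithmic parent. Let $\mathcal C_i=\{j\in\mathcal N:\sigma_j=i\}$. For each $j\in\mathcal N$ having an algorithmic parent and each $t\in\mathbb N$, there are delays $\tau^{\uparrow}_j(t),\tau^{\downarrow}_j(t)\in\mathbb Z_{\ge0}$, all bounded by $\tau_{\max}$. Write $[x]_a^b=\min(\max(x,a),b)$ and $\lceil x\rceil_+=\max(x,0)$. Initialization ($t=0$): for all $i\in\mathcal N$, $z_i^P(0)=z_i^Q(0)=\underline\lambda_i(0)=\bar\lambda_i(0)=\lambda_i(0)=0$ and $\alpha_i(0)=\beta_i^P(0)=\beta_i^Q(0)=\hat\alpha_i(0)=\hat\beta_i^P(0)=\hat\beta_i^Q(0)=0$;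 any message $\alpha_i(s),\beta_i^P(s),\beta_i^Q(s)$ with $s<0$ is $0$; if $i$ has no algorithmic parent then $\hat\beta_i^P(t)=\hat\beta_i^Q(t)=0$ for all $t$. For $t=0,1,2,\dots$ and every $i\in\mathcal N$: (1) $p_i(t)=\bigl[(z_i^P(t)-b_i^P)/a_i^P\bigr]_{\underline p_i}^{\bar p_i}$ and $q_i(t)=\bigl[(z_i^Q(t)-b_i^Q)/a_i^Q\bigr]_{\underline q_i}^{\bar q_i}$. (2) $v(t)=v(p(t),q(t))$; $\underline\lambda_i(t+1)=\lceil\underline\lambda_i(t)+\gamma(\underline v_i-v_i(t))\rceil_+$, $\bar\lambda_i(t+1)=\lceil\bar\lambda_i(t)+\gamma(v_i(t)-\bar v_i)\rceil_+$, $\lambda_i(t+1)=\underline\lambda_i(t+1)-\bar\lambda_i(t+1)$, with step size $\gamma>0$. (3) $\alpha_i(t+1)=\lambda_i(t+1)+\sum_{j\in\mathcal C_i}\hat\alpha_j(t)$, and for each $j\in\mathcal C_i$: $\beta_j^P(t+1)=R_{ii}\bigl(\lambda_i(t+1)+\sum_{r\in\mathcal C_i\setminus\{j\}}\hat\alpha_r(t)\bigr)+\hat\beta_i^P(t)$ and $\beta_j^Q(t+1)=X_{ii}\bigl(\lambda_i(t+1)+\sum_{r\in\mathcal C_i\setminus\{j\}}\hat\alpha_r(t)\bigr)+\hat\beta_i^Q(t)$. For each $j$ with an algorithmic parent: $\hat\alpha_j(t+1)=\alpha_j(t+1-\tau^{\uparrow}_j(t))$, $\hat\beta_j^P(t+1)=\beta_j^P(t+1-\tau^{\downarrow}_j(t))$,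 $\hat\beta_j^Q(t+1)=\beta_j^Q(t+1-\tau^{\downarrow}_j(t))$. (4) $z_i^P(t+1)=R_{ii}\bigl(\lambda_i(t+1)+\sum_{j\in\mathcal C_i}\hat\alpha_j(t+1)\bigr)+\hat\beta_i^P(t+1)$ and $z_i^Q(t+1)=X_{ii}\bigl(\lambda_i(t+1)+\sum_{j\in\mathcal C_i}\hat\alpha_j(t+1)\bigr)+\hat\beta_i^Q(t+1)$. *)

theory Defs
  imports Complex_Main
begin

text \<open>Nodes are 0..N, node 0 is the root; vectors in R^N are functions nat => real
  of which only the entries 1..N matter.  The edge (sigma k, k) is identified with its
  child endpoint k; its resistance/reactance are r k, x k.\<close>

record pdata =
  nN   :: nat
  sig  :: "nat \<Rightarrow> nat"
  res  :: "nat \<Rightarrow> real"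
  rea  :: "nat \<Rightarrow> real"
  v0   :: real
  vlo  :: "nat \<Rightarrow> real"
  vhi  :: "nat \<Rightarrow> real"
  plo  :: "nat \<Rightarrow> real"
  phi  :: "nat \<Rightarrow> real"
  qlo  :: "nat \<Rightarrow> real"
  qhi  :: "nat \<Rightarrow> real"
  aP   :: "nat \<Rightarrow> real"
  bP   :: "nat \<Rightarrow> real"
  cP   :: "nat \<Rightarrow> real"
  aQ   :: "nat \<Rightarrow> real"
  bQ   :: "nat \<Rightarrow> real"
  cQ   :: "nat \<Rightarrow> real"

definition nodes :: "pdata \<Rightarrow> nat set" where
  "nodes D = {1..nN D}"

definition radial :: "pdata \<Rightarrow> bool" where
  "radial D \<longleftrightarrow> (\<forall>i\<in>nodes D. sig D i \<le> nN D \<and> (\<exists>m. (sig D ^^ m) i = 0))"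

text \<open>Nodes k in 1..N on the path from the root to i; the edges of the path P_i are
  exactly the edges (sigma k, k) with k in anc D i.\<close>
definition anc :: "pdata \<Rightarrow> nat \<Rightarrow> nat set" where
  "anc D i = {k \<in> nodes D. \<exists>m. (sig D ^^ m) i = k \<and> (\<forall>m'\<le>m. (sig D ^^ m') i \<noteq> 0)}"

definition Rm :: "pdata \<Rightarrow> nat \<Rightarrow> nat \<Rightarrow> real" where
  "Rm D i j = 2 * (\<Sum>k\<in>anc D i \<inter> anc D j. res D k)"

definition Xm :: "pdata \<Rightarrow> nat \<Rightarrow> nat \<Rightarrow> real" where
  "Xm D i j = 2 * (\<Sum>k\<in>anc D i \<inter> anc D j. rea D k)"

definition children :: "pdata \<Rightarrow> nat \<Rightarrow> nat set" where
  "children D i = {j \<in> nodes D. sig D j = i}"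

definition adj :: "pdata \<Rightarrow> nat \<Rightarrow> nat \<Rightarrow> bool" where
  "adj D u v \<longleftrightarrow> (u \<in> nodes D \<and> sig D u = v) \<or> (v \<in> nodes D \<and> sig D v = u)"

definition tdist :: "pdata \<Rightarrow> nat \<Rightarrow> nat \<Rightarrow> nat" where
  "tdist D i j = (LEAST n. \<exists>w. length w = Suc n \<and> hd w = i \<and> last w = j \<and>
                              (\<forall>k<n. adj D (w ! k) (w ! Suc k)))"

definition diam :: "pdata \<Rightarrow> nat" where
  "diam D = Max {tdist D i j | i j. i \<in> nodes D \<and> j \<in> nodes D}"

definition vnorm :: "pdata \<Rightarrow> (nat \<Rightarrow> real) \<Rightarrow> real" where
  "vnorm D v = sqrt (\<Sum>i\<in>nodes D. (v i)\<^sup>2)"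

definition mvec :: "pdata \<Rightarrow> (nat \<Rightarrow> nat \<Rightarrow> real) \<Rightarrow> (nat \<Rightarrow> real) \<Rightarrow> nat \<Rightarrow> real" where
  "mvec D A v i = (\<Sum>j\<in>nodes D. A i j * v j)"

definition specnorm :: "pdata \<Rightarrow> (nat \<Rightarrow> nat \<Rightarrow> real) \<Rightarrow> real" where
  "specnorm D A = Sup {vnorm D (mvec D A v) | v. vnorm D v \<le> 1}"

definition amin :: "pdata \<Rightarrow> real" where
  "amin D = Min (aP D ` nodes D \<union> aQ D ` nodes D)"

definition Lconst :: "pdata \<Rightarrow> real" where
  "Lconst D = 2 * ((specnorm D (Rm D))\<^sup>2 + (specnorm D (Xm D))\<^sup>2) / amin D"

definition volt :: "pdata \<Rightarrow> (nat \<Rightarrow> real) \<Rightarrow> (nat \<Rightarrow> real) \<Rightarrow> nat \<Rightarrow> real" where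
  "volt D p q i = mvec D (Rm D) p i + mvec D (Xm D) q i + v0 D"

definition cost :: "pdata \<Rightarrow> (nat \<Rightarrow> real) \<Rightarrow> (nat \<Rightarrow> real) \<Rightarrow> real" where
  "cost D p q = (\<Sum>i\<in>nodes D. aP D i / 2 * (p i)\<^sup>2 + bP D i * p i + cP D i)
              + (\<Sum>i\<in>nodes D. aQ D i / 2 * (q i)\<^sup>2 + bQ D i * q i + cQ D i)"

definition feasible :: "pdata \<Rightarrow> (nat \<Rightarrow> real) \<Rightarrow> (nat \<Rightarrow> real) \<Rightarrow> bool" where
  "feasible D p q \<longleftrightarrow> (\<forall>i\<in>nodes D.
      vlo D i \<le> volt D p q i \<and> volt D p q i \<le> vhi D i \<and>
      plo D i \<le> p i \<and> p i \<le> phi D i \<and> qlo D i \<le> q i \<and> q i \<le> qhi D i)"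

definition optimal :: "pdata \<Rightarrow> (nat \<Rightarrow> real) \<Rightarrow> (nat \<Rightarrow> real) \<Rightarrow> bool" where
  "optimal D p q \<longleftrightarrow> feasible D p q \<and> (\<forall>p' q'. feasible D p' q' \<longrightarrow> cost D p q \<le> cost D p' q')"

definition slater :: "pdata \<Rightarrow> bool" where
  "slater D \<longleftrightarrow> (\<exists>p q. \<forall>i\<in>nodes D.
      vlo D i < volt D p q i \<and> volt D p q i < vhi D i \<and>
      plo D i < p i \<and> p i < phi D i \<and> qlo D i < q i \<and> q i < qhi D i)"

definition clampr :: "real \<Rightarrow> real \<Rightarrow> real \<Rightarrow> real" where
  "clampr x a b = min (max x a) b"

record st =
  s_lo  :: "nat \<Rightarrow> real"
  s_hi  :: "nat \<Rightarrow> real"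
  s_zP  :: "nat \<Rightarrow> real"
  s_zQ  :: "nat \<Rightarrow> real"
  s_al  :: "nat \<Rightarrow> real"
  s_bP  :: "nat \<Rightarrow> real"
  s_bQ  :: "nat \<Rightarrow> real"
  s_ah  :: "nat \<Rightarrow> real"
  s_bhP :: "nat \<Rightarrow> real"
  s_bhQ :: "nat \<Rightarrow> real"

definition st0 :: st where
  "st0 = \<lparr>s_lo = (\<lambda>_. 0), s_hi = (\<lambda>_. 0), s_zP = (\<lambda>_. 0), s_zQ = (\<lambda>_. 0),
          s_al = (\<lambda>_. 0), s_bP = (\<lambda>_. 0), s_bQ = (\<lambda>_. 0),
          s_ah = (\<lambda>_. 0), s_bhP = (\<lambda>_. 0), s_bhQ = (\<lambda>_. 0)\<rparr>"

definition pof :: "pdata \<Rightarrow> (nat \<Rightarrow> real) \<Rightarrow> nat \<Rightarrow> real" where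
  "pof D z i = clampr ((z i - bP D i) / aP D i) (plo D i) (phi D i)"

definition qof :: "pdata \<Rightarrow> (nat \<Rightarrow> real) \<Rightarrow> nat \<Rightarrow> real" where
  "qof D z i = clampr ((z i - bQ D i) / aQ D i) (qlo D i) (qhi D i)"

text \<open>Delayed read of a message stream: the value sent at time (t+1) - tau, where
  messages with negative time stamp are 0.  The value at time t+1 is passed explicitly
  (it is the value just computed); earlier values come from the history H.\<close>
definition delayed :: "(nat \<Rightarrow> st) \<Rightarrow> (st \<Rightarrow> nat \<Rightarrow> real) \<Rightarrow> real \<Rightarrow> nat \<Rightarrow> nat \<Rightarrow> nat \<Rightarrow> real" where
  "delayed H f new j t tau =
     (if tau = 0 then new
      else if tau \<le> Suc t then f (H (Suc t - tau)) j else 0)"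

text \<open>One iteration t -> t+1 of DIST-OPT, given the history H (states at times 0..t).
  tu j t, td j t are the delays tau-up and tau-down.\<close>
definition step :: "pdata \<Rightarrow> real \<Rightarrow> (nat \<Rightarrow> nat \<Rightarrow> nat) \<Rightarrow> (nat \<Rightarrow> nat \<Rightarrow> nat)
                      \<Rightarrow> (nat \<Rightarrow> st) \<Rightarrow> nat \<Rightarrow> st" where
  "step D \<gamma> tu td H t =
    (let S = H t;
         p = pof D (s_zP S);
         q = qof D (s_zQ S);
         vt = volt D p q;
         lo' = (\<lambda>i. max 0 (s_lo S i + \<gamma> * (vlo D i - vt i)));
         hi' = (\<lambda>i. max 0 (s_hi S i + \<gamma> * (vt i - vhi D i)));
         lam' = (\<lambda>i. lo' i - hi' i);
         al' = (\<lambda>i. lam' i + (\<Sum>j\<in>children D i. s_ah S j));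
         bP' = (\<lambda>j. if sig D j \<noteq> 0 then
                     Rm D (sig D j) (sig D j) *
                       (lam' (sig D j) + (\<Sum>r\<in>children D (sig D j) - {j}. s_ah S r))
                     + s_bhP S (sig D j) else 0);
         bQ' = (\<lambda>j. if sig D j \<noteq> 0 then
                     Xm D (sig D j) (sig D j) *
                       (lam' (sig D j) + (\<Sum>r\<in>children D (sig D j) - {j}. s_ah S r))
                     + s_bhQ S (sig D j) else 0);
         ah' = (\<lambda>j. if sig D j \<noteq> 0 then delayed H s_al (al' j) j t (tu j t) else 0);
         bhP' = (\<lambda>j. if sig D j \<noteq> 0 then delayed H s_bP (bP' j) j t (td j t) else 0);
         bhQ' = (\<lambda>j. if sig D j \<noteq> 0 then delayed H s_bQ (bQ' j) j t (td j t) else 0);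
         zP' = (\<lambda>i. Rm D i i * (lam' i + (\<Sum>j\<in>children D i. ah' j)) + bhP' i);
         zQ' = (\<lambda>i. Xm D i i * (lam' i + (\<Sum>j\<in>children D i. ah' j)) + bhQ' i)
     in \<lparr>s_lo = lo', s_hi = hi', s_zP = zP', s_zQ = zQ', s_al = al', s_bP = bP', s_bQ = bQ',
         s_ah = ah', s_bhP = bhP', s_bhQ = bhQ'\<rparr>)"

text \<open>hist D gamma tu td t s = state at time s, valid for s <= t.\<close>
primrec hist :: "pdata \<Rightarrow> real \<Rightarrow> (nat \<Rightarrow> nat \<Rightarrow> nat) \<Rightarrow> (nat \<Rightarrow> nat \<Rightarrow> nat)
                   \<Rightarrow> nat \<Rightarrow> nat \<Rightarrow> st" where
  "hist D \<gamma> tu td 0 = (\<lambda>_. st0)"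
| "hist D \<gamma> tu td (Suc t) =
     (hist D \<gamma> tu td t)(Suc t := step D \<gamma> tu td (hist D \<gamma> tu td t) t)"

definition traj :: "pdata \<Rightarrow> real \<Rightarrow> (nat \<Rightarrow> nat \<Rightarrow> nat) \<Rightarrow> (nat \<Rightarrow> nat \<Rightarrow> nat) \<Rightarrow> nat \<Rightarrow> st" where
  "traj D \<gamma> tu td t = hist D \<gamma> tu td t t"

definition p_alg :: "pdata \<Rightarrow> real \<Rightarrow> (nat \<Rightarrow> nat \<Rightarrow> nat) \<Rightarrow> (nat \<Rightarrow> nat \<Rightarrow> nat) \<Rightarrow> nat \<Rightarrow> nat \<Rightarrow> real" where
  "p_alg D \<gamma> tu td t = pof D (s_zP (traj D \<gamma> tu td t))"

definition q_alg :: "pdata \<Rightarrow> real \<Rightarrow> (nat \<Rightarrow> nat \<Rightarrow> nat) \<Rightarrow> (nat \<Rightarrow> nat \<Rightarrow> nat) \<Rightarrow> nat \<Rightarrow> nat \<Rightarrow> real" where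
  "q_alg D \<gamma> tu td t = qof D (s_zQ (traj D \<gamma> tu td t))"

end

theory Submission
  imports Defs "HOL-Analysis.Analysis"
begin

text \<open>
  DIST-OPT is projected gradient ascent on the Lagrangian dual in which the primal response is
  evaluated at outdated multipliers: unrolling the message recursion gives
  \<open>z\<^sub>i(t) = (\<Sum>j. R\<^sub>i\<^sub>j \<lambda>\<^sub>j(t - \<delta>\<^sub>i\<^sub>j(t)))\<close> with \<open>\<delta>\<^sub>i\<^sub>j(t) \<le> (\<tau>max + 1) dist(i, j)\<close>, and in particular
  \<open>\<delta>\<^sub>i\<^sub>i(t) = 0\<close>.  One step increases the dual value by \<open>1/\<gamma> - L/2\<close> times the squared step
  length, up to a delay error that only involves the off-diagonal part of \<open>R\<close> and \<open>X\<close>.  Since a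
  sum over a subtree satisfies \<open>(\<Sum>x\<^sub>i)\<^sup>2 \<le> N (\<Sum>x\<^sub>i\<^sup>2)\<close>, the off-diagonal part has norm at most
  \<open>(1 - 1/N) \<parallel>R\<parallel>\<close>; as \<open>2 (1 - 1/N) \<le> sqrt N\<close>, the step-size condition makes the total gain a
  positive multiple of the sum of the squared step lengths.  By Slater's condition the dual is
  bounded above and its superlevel sets are bounded, so the steps tend to zero and the multipliers
  stay bounded.  Hence infeasibility and complementary slackness of the primal response vanish in
  the limit; strong convexity of the Lagrangian, together with mixing in the Slater point to
  restore feasibility, then bounds the distance to the optimum.
\<close>

section \<open>Ancestors and tree distance\<close>

lemma finite_nodes [simp]: "finite (nodes D)"
  by (simp add: nodes_def)

lemma finite_anc [simp]: "finite (anc D i)"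
  by (rule finite_subset[of _ "nodes D"]) (auto simp: anc_def)

lemma anc_subset: "anc D i \<subseteq> nodes D"
  by (auto simp: anc_def)

lemma anc_zero [simp]: "anc D 0 = {}"
  by (force simp: anc_def)

lemma card_Diff_triangle:
  assumes "finite A" "finite B"
  shows "card (A - C) \<le> card (A - B) + card (B - C)"
proof -
  have "card (A - C) \<le> card ((A - B) \<union> (B - C))"
    using assms by (intro card_mono) auto
  also have "\<dots> \<le> card (A - B) + card (B - C)" by (rule card_Un_le)
  finally show ?thesis .
qed

locale radial_network =
  fixes D :: pdata
  assumes radial: "radial D"
begin

lemma sig_le: "i \<in> nodes D \<Longrightarrow> sig D i \<le> nN D"
  using radial by (simp add: radial_def)

lemma sig_in_nodes: "i \<in> nodes D \<Longrightarrow> sig D i \<noteq> 0 \<Longrightarrow> sig D i \<in> nodes D"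
  using sig_le by (auto simp: nodes_def)

lemma anc_rec:
  assumes "i \<in> nodes D"
  shows "anc D i = insert i (anc D (sig D i))"
proof (intro equalityI subsetI)
  fix k assume "k \<in> anc D i"
  then obtain m where m: "k \<in> nodes D" "(sig D ^^ m) i = k" "\<forall>m'\<le>m. (sig D ^^ m') i \<noteq> 0"
    by (auto simp: anc_def)
  show "k \<in> insert i (anc D (sig D i))"
  proof (cases m)
    case 0 then show ?thesis using m by simp
  next
    case (Suc n)
    have "(sig D ^^ m') (sig D i) \<noteq> 0" if "m' \<le> n" for m'
      using m(3)[rule_format, of "Suc m'"] that Suc by (simp add: funpow_swap1)
    then show ?thesis using m Suc by (auto simp: anc_def funpow_swap1)
  qed
next
  fix k assume "k \<in> insert i (anc D (sig D i))"
  then consider "k = i" | "k \<in> anc D (sig D i)" by auto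
  then show "k \<in> anc D i"
  proof cases
    case 1
    have "i \<noteq> 0" using assms by (auto simp: nodes_def)
    then show ?thesis unfolding anc_def using assms 1 by (auto intro!: exI[of _ 0])
  next
    case 2
    then obtain m where m: "k \<in> nodes D" "(sig D ^^ m) (sig D i) = k"
      "\<forall>m'\<le>m. (sig D ^^ m') (sig D i) \<noteq> 0"
      by (auto simp: anc_def)
    have "i \<noteq> 0" using assms by (auto simp: nodes_def)
    then have "(sig D ^^ m') i \<noteq> 0" if "m' \<le> Suc m" for m'
      using m(3) that by (cases m') (auto simp: funpow_swap1)
    then show ?thesis using m unfolding anc_def
      by (auto intro!: exI[of _ "Suc m"] simp: funpow_swap1)
  qed
qed

lemma self_in_anc: "i \<in> nodes D \<Longrightarrow> i \<in> anc D i"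
  using anc_rec by blast

lemma not_in_anc_sig:
  assumes "i \<in> nodes D"
  shows "i \<notin> anc D (sig D i)"
proof
  assume "i \<in> anc D (sig D i)"
  then obtain m where m: "(sig D ^^ Suc m) i = i" "\<forall>m'\<le>m. (sig D ^^ Suc m') i \<noteq> 0"
    by (auto simp: anc_def funpow_swap1)
  obtain n where n: "(sig D ^^ n) i = 0"
    using radial assms by (auto simp: radial_def)
  have "(sig D ^^ (n mod Suc m)) i = 0"
    using n funpow_mod_eq[OF m(1)] by simp
  moreover have "n mod Suc m \<le> m" by (simp add: less_Suc_eq_le[symmetric])
  moreover have "i \<noteq> 0" using assms by (auto simp: nodes_def)
  ultimately show False using m(2)
    by (cases "n mod Suc m") (auto dest: spec[of _ "n mod Suc m - 1"])
qed

lemma node_induct [consumes 1, case_names node]: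
  assumes "i \<in> nodes D"
    and "\<And>i. i \<in> nodes D \<Longrightarrow> (sig D i \<noteq> 0 \<Longrightarrow> P (sig D i)) \<Longrightarrow> P i"
  shows "P i"
  using assms(1)
proof (induction "card (anc D i)" arbitrary: i rule: less_induct)
  case less
  show ?case
  proof (rule assms(2)[OF less.prems])
    assume "sig D i \<noteq> 0"
    then have "sig D i \<in> nodes D" using less.prems sig_in_nodes by blast
    moreover have "card (anc D (sig D i)) < card (anc D i)"
      using less.prems by (simp add: anc_rec[of i] not_in_anc_sig)
    ultimately show "P (sig D i)" using less.hyps by blast
  qed
qed

lemma anc_mono: "i \<in> nodes D \<Longrightarrow> k \<in> anc D i \<Longrightarrow> anc D k \<subseteq> anc D i"
proof (induction i rule: node_induct)
  case (node i)
  then show ?case using anc_rec[of i] by (cases "sig D i = 0") auto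
qed

definition gap :: "nat \<Rightarrow> nat \<Rightarrow> nat" where
  "gap i j = card (anc D i - anc D j) + card (anc D j - anc D i)"

lemma gap_self [simp]: "gap i i = 0"
  by (simp add: gap_def)

lemma gap_commute: "gap i j = gap j i"
  by (simp add: gap_def)

lemma gap_triangle: "gap i k \<le> gap i j + gap j k"
  using card_Diff_triangle[of "anc D i" "anc D j" "anc D k"]
    card_Diff_triangle[of "anc D k" "anc D j" "anc D i"]
  by (simp add: gap_def)

lemma gap_adj:
  assumes "adj D u v" shows "gap u v \<le> 1"
proof -
  have "gap u (sig D u) \<le> 1" if "u \<in> nodes D" for u
  proof -
    have "anc D u - anc D (sig D u) = {u}" "anc D (sig D u) - anc D u = {}"
      using anc_rec[OF that] not_in_anc_sig[OF that] by auto
    then show ?thesis by (simp add: gap_def)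
  qed
  then show ?thesis using assms gap_commute by (auto simp: adj_def)
qed

lemma gap_relpowp: "(adj D ^^ n) i j \<Longrightarrow> gap i j \<le> n"
proof (induction n arbitrary: j)
  case (Suc n)
  then obtain k where "(adj D ^^ n) i k" "adj D k j" by auto
  then show ?case using Suc.IH[of k] gap_adj[of k j] gap_triangle[of i j k] by linarith
qed simp

lemma walk_iff_relpowp:
  "(\<exists>w. length w = Suc n \<and> hd w = i \<and> last w = j \<and> (\<forall>k<n. adj D (w ! k) (w ! Suc k)))
    \<longleftrightarrow> (adj D ^^ n) i j"
proof
  assume "\<exists>w. length w = Suc n \<and> hd w = i \<and> last w = j \<and> (\<forall>k<n. adj D (w ! k) (w ! Suc k))"
  then obtain w where "length w = Suc n" "hd w = i" "last w = j"
    "\<forall>k<n. adj D (w ! k) (w ! Suc k)" by blast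
  then show "(adj D ^^ n) i j"
    unfolding relpowp_fun_conv
    by (intro exI[of _ "\<lambda>k. w ! k"])
       (metis diff_Suc_1 hd_conv_nth last_conv_nth length_0_conv nat.distinct(1))
next
  assume "(adj D ^^ n) i j"
  then obtain f where f: "f 0 = i" "f n = j" "\<forall>k<n. adj D (f k) (f (Suc k))"
    unfolding relpowp_fun_conv by blast
  let ?w = "map f [0..<Suc n]"
  have "hd ?w = i" using f by (simp add: hd_map upt_rec)
  moreover have "last ?w = j" using f by simp
  moreover have "?w ! k = f k" if "k \<le> n" for k
    using that by (metis add_0 diff_zero le_imp_less_Suc length_upt nth_map nth_upt)
  ultimately show "\<exists>w. length w = Suc n \<and> hd w = i \<and> last w = j \<and> (\<forall>k<n. adj D (w ! k) (w ! Suc k))"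
    using f by (intro exI[of _ ?w]) auto
qed

lemma adj_rtranclp_root: "i \<in> nodes D \<Longrightarrow> (adj D)\<^sup>*\<^sup>* i 0"
proof (induction i rule: node_induct)
  case (node i)
  have "adj D i (sig D i)" using node.hyps by (simp add: adj_def)
  then show ?case using node.IH
    by (cases "sig D i = 0") (auto intro: converse_rtranclp_into_rtranclp)
qed

lemma gap_le_tdist:
  assumes "i \<in> nodes D" "j \<in> nodes D"
  shows "gap i j \<le> tdist D i j"
proof -
  have sym: "symp (adj D)" by (auto simp: symp_def adj_def)
  have "(adj D)\<^sup>*\<^sup>* i j"
    using adj_rtranclp_root[OF assms(1)] adj_rtranclp_root[OF assms(2)]
      symp_rtranclp[OF sym] by (meson rtranclp_trans sympD)
  then obtain n where "(adj D ^^ n) i j" by (auto dest: rtranclp_imp_relpowp)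
  then have "(adj D ^^ tdist D i j) i j"
    unfolding tdist_def walk_iff_relpowp by (rule LeastI)
  then show ?thesis by (rule gap_relpowp)
qed

lemma gap_le_diam:
  assumes "i \<in> nodes D" "j \<in> nodes D"
  shows "gap i j \<le> diam D"
proof -
  have "{tdist D i j |i j. i \<in> nodes D \<and> j \<in> nodes D}
      = (\<lambda>(i, j). tdist D i j) ` (nodes D \<times> nodes D)" by auto
  then have "tdist D i j \<le> diam D"
    unfolding diam_def using assms by (intro Max_ge) auto
  then show ?thesis using gap_le_tdist[OF assms] by linarith
qed

end

section \<open>Unrolling the delayed messages\<close>

definition kern :: "pdata \<Rightarrow> (nat \<Rightarrow> real) \<Rightarrow> nat \<Rightarrow> nat \<Rightarrow> real" where
  "kern D w i j = 2 * (\<Sum>k\<in>anc D i \<inter> anc D j. w k)"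

lemma Rm_eq_kern: "Rm D = kern D (res D)"
  by (intro ext) (simp add: Rm_def kern_def)

lemma Xm_eq_kern: "Xm D = kern D (rea D)"
  by (intro ext) (simp add: Xm_def kern_def)

lemma kern_commute: "kern D w i j = kern D w j i"
  by (simp add: kern_def Int_commute)

definition delayed_sum ::
  "(nat \<Rightarrow> nat \<Rightarrow> real) \<Rightarrow> nat \<Rightarrow> nat set \<Rightarrow> (nat \<Rightarrow> real) \<Rightarrow> (nat \<Rightarrow> nat) \<Rightarrow> real \<Rightarrow> bool" where
  "delayed_sum lam t S W B V \<longleftrightarrow>
     (\<exists>\<delta>. (\<forall>j\<in>S. \<delta> j \<le> B j) \<and> V = (\<Sum>j\<in>S. W j * lam (t - \<delta> j) j))"

lemma delayed_sum_shift:
  assumes "delayed_sum lam (t - k) S W B V"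
  shows "delayed_sum lam t S W (\<lambda>j. B j + k) V"
proof -
  obtain \<delta> where "\<forall>j\<in>S. \<delta> j \<le> B j" "V = (\<Sum>j\<in>S. W j * lam (t - k - \<delta> j) j)"
    using assms by (auto simp: delayed_sum_def)
  then show ?thesis unfolding delayed_sum_def
    by (intro exI[of _ "\<lambda>j. \<delta> j + k"]) (auto simp: add.commute)
qed

lemma delayed_sum_weaken:
  assumes "delayed_sum lam t S W B V" and "\<And>j. j \<in> S \<Longrightarrow> B j \<le> B' j"
    and "\<And>j. j \<in> S \<Longrightarrow> W j = W' j"
  shows "delayed_sum lam t S W' B' V"
proof -
  obtain \<delta> where "\<forall>j\<in>S. \<delta> j \<le> B j" "V = (\<Sum>j\<in>S. W j * lam (t - \<delta> j) j)"
    using assms(1) by (auto simp: delayed_sum_def)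
  then show ?thesis unfolding delayed_sum_def using assms(2,3)
    by (intro exI[of _ \<delta>]) (auto intro!: sum.cong order_trans[OF _ assms(2)])
qed

lemma delayed_sum_scale:
  "delayed_sum lam t S W B V \<Longrightarrow> delayed_sum lam t S (\<lambda>j. c * W j) B (c * V)"
  unfolding delayed_sum_def by (auto simp: sum_distrib_left mult.assoc)

lemma delayed_sum_Un:
  assumes "delayed_sum lam t S W B V" "delayed_sum lam t S' W B V'"
    and "finite S" "finite S'" "S \<inter> S' = {}"
  shows "delayed_sum lam t (S \<union> S') W B (V + V')"
proof -
  obtain \<delta> \<delta>' where *: "\<forall>j\<in>S. \<delta> j \<le> B j" "V = (\<Sum>j\<in>S. W j * lam (t - \<delta> j) j)"
    "\<forall>j\<in>S'. \<delta>' j \<le> B j" "V' = (\<Sum>j\<in>S'. W j * lam (t - \<delta>' j) j)"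
    using assms by (auto simp: delayed_sum_def)
  let ?d = "\<lambda>j. if j \<in> S then \<delta> j else \<delta>' j"
  have "(\<Sum>j\<in>S'. W j * lam (t - ?d j) j) = V'"
    unfolding * using assms(5) by (intro sum.cong) auto
  then have "V + V' = (\<Sum>j\<in>S \<union> S'. W j * lam (t - ?d j) j)"
    using * assms(3-5) by (simp add: sum.union_disjoint)
  then show ?thesis unfolding delayed_sum_def using * by (intro exI[of _ ?d]) auto
qed

lemma delayed_sum_zero:
  assumes "\<And>j. j \<in> S \<Longrightarrow> W j = 0" shows "delayed_sum lam t S W B 0"
  unfolding delayed_sum_def using assms by (intro exI[of _ "\<lambda>_. 0"]) auto

lemma delayed_sum_init:
  assumes "\<And>j. lam 0 j = 0" shows "delayed_sum lam 0 S W B 0"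
  unfolding delayed_sum_def using assms by (intro exI[of _ "\<lambda>_. 0"]) auto

lemma delayed_sum_single: "delayed_sum lam t {i} (\<lambda>_. 1) B (lam t i)"
  unfolding delayed_sum_def by (intro exI[of _ "\<lambda>_. 0"]) auto

lemma delayed_sum_UN:
  assumes "finite C" and "\<And>c. c \<in> C \<Longrightarrow> delayed_sum lam t (S c) W B (V c)"
    and "\<And>c. c \<in> C \<Longrightarrow> finite (S c)"
    and "\<And>c d. c \<in> C \<Longrightarrow> d \<in> C \<Longrightarrow> c \<noteq> d \<Longrightarrow> S c \<inter> S d = {}"
  shows "delayed_sum lam t (\<Union>c\<in>C. S c) W B (\<Sum>c\<in>C. V c)"
  using assms
proof (induction C rule: finite_induct)
  case empty
  then show ?case by (simp add: delayed_sum_def)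
next
  case (insert c C)
  have "delayed_sum lam t (S c \<union> (\<Union>c\<in>C. S c)) W B (V c + (\<Sum>c\<in>C. V c))"
  proof (rule delayed_sum_Un)
    show "S c \<inter> (\<Union>c\<in>C. S c) = {}" using insert.prems(3)[of c] insert.hyps by auto
  qed (use insert in auto)
  then show ?case using insert.hyps by simp
qed

context radial_network
begin

definition subtree :: "nat \<Rightarrow> nat set" where
  "subtree i = {j \<in> nodes D. i \<in> anc D j}"

lemma finite_subtree [simp]: "finite (subtree i)"
  by (simp add: subtree_def)

lemma subtree_subset: "subtree i \<subseteq> nodes D"
  by (auto simp: subtree_def)

lemma finite_children [simp]: "finite (children D i)"
  by (simp add: children_def)

lemma self_in_subtree: "i \<in> nodes D \<Longrightarrow> i \<in> subtree i"
  by (simp add: subtree_def self_in_anc)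

lemma anc_chain:
  assumes "j \<in> nodes D" "c \<in> anc D j" "d \<in> anc D j"
  shows "c \<in> anc D d \<or> d \<in> anc D c"
  using assms
proof (induction j rule: node_induct)
  case (node j)
  have "c \<in> anc D j" "d \<in> anc D j" by fact+
  moreover have "sig D j = 0 \<Longrightarrow> anc D j = {j}"
    using node.hyps by (simp add: anc_rec)
  ultimately show ?case using node.IH anc_rec[OF node.hyps] self_in_anc[OF node.hyps]
    by (cases "sig D j = 0") auto
qed

lemma children_subtree_disjoint:
  assumes "c \<in> children D i" "d \<in> children D i" "c \<noteq> d"
  shows "subtree c \<inter> subtree d = {}"
proof (rule ccontr)
  assume "subtree c \<inter> subtree d \<noteq> {}"
  then obtain j where "j \<in> nodes D" "c \<in> anc D j" "d \<in> anc D j"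
    by (auto simp: subtree_def)
  then have "c \<in> anc D d \<or> d \<in> anc D c" by (rule anc_chain)
  then show False
    using assms not_in_anc_sig[of c] not_in_anc_sig[of d] anc_rec[of c] anc_rec[of d]
    by (auto simp: children_def)
qed

lemma sig_in_anc:
  assumes "c \<in> nodes D" "sig D c \<noteq> 0" shows "sig D c \<in> anc D c"
  using assms anc_rec[of c] self_in_anc[of "sig D c"] sig_in_nodes by auto

lemma subtree_rec:
  assumes "i \<in> nodes D"
  shows "subtree i = insert i (\<Union>c\<in>children D i. subtree c)"
proof (intro equalityI subsetI)
  fix j assume "j \<in> subtree i"
  then have "j \<in> nodes D" "i \<in> anc D j" by (auto simp: subtree_def)
  then show "j \<in> insert i (\<Union>c\<in>children D i. subtree c)"
  proof (induction j rule: node_induct)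
    case (node j)
    show ?case
    proof (cases "j = i \<or> sig D j = i")
      case True
      then show ?thesis using node.hyps by (auto simp: children_def self_in_subtree)
    next
      case False
      then have i: "i \<in> anc D (sig D j)" using node.prems anc_rec[OF node.hyps] by auto
      then have "sig D j \<noteq> 0" by (metis anc_zero empty_iff)
      then obtain c where "c \<in> children D i" "sig D j \<in> subtree c"
        using node.IH i False by auto
      then show ?thesis using node.hyps anc_rec[OF node.hyps] by (auto simp: subtree_def)
    qed
  qed
next
  fix j assume j: "j \<in> insert i (\<Union>c\<in>children D i. subtree c)"
  show "j \<in> subtree i"
  proof (cases "j = i")
    case True then show ?thesis using assms self_in_subtree by simp
  next
    case False
    then obtain c where c: "c \<in> nodes D" "sig D c = i" "j \<in> nodes D" "c \<in> anc D j"
      using j by (auto simp: children_def subtree_def)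
    have "i \<noteq> 0" using assms by (auto simp: nodes_def)
    then have "i \<in> anc D j"
      using sig_in_anc[of c] anc_mono[of j c] c by auto
    then show ?thesis using c by (simp add: subtree_def)
  qed
qed

lemma not_in_subtree_child:
  assumes "c \<in> children D i" shows "i \<notin> subtree c"
  using assms not_in_anc_sig by (auto simp: subtree_def children_def)

lemma gap_descend:
  assumes "c \<in> children D i" "l \<in> subtree c"
  shows "gap i l = Suc (gap c l)"
proof -
  have c: "c \<in> nodes D" "sig D c = i" "l \<in> nodes D" "c \<in> anc D l"
    using assms by (auto simp: children_def subtree_def)
  have "anc D c \<subseteq> anc D l" using anc_mono c by blast
  moreover have "anc D c = insert c (anc D i)" "c \<notin> anc D i"
    using anc_rec[OF c(1)] not_in_anc_sig[OF c(1)] c by auto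
  ultimately have e: "anc D c - anc D l = {}" "anc D i - anc D l = {}"
    "anc D l - anc D i = insert c (anc D l - anc D c)" using c by auto
  show ?thesis unfolding gap_def e using self_in_anc[OF c(1)] by simp
qed

lemma gap_ascend:
  assumes "i \<in> nodes D" "l \<notin> subtree i" "l \<in> nodes D"
  shows "gap i l = Suc (gap (sig D i) l)"
proof -
  have "anc D i = insert i (anc D (sig D i))" "i \<notin> anc D (sig D i)" "i \<notin> anc D l"
    using anc_rec not_in_anc_sig assms by (auto simp: subtree_def)
  then have e: "anc D i - anc D l = insert i (anc D (sig D i) - anc D l)"
    "anc D l - anc D i = anc D l - anc D (sig D i)" by auto
  show ?thesis unfolding gap_def e using \<open>i \<notin> anc D (sig D i)\<close> by simp
qed

lemma kern_subtree:
  assumes "i \<in> nodes D" "l \<in> subtree i"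
  shows "kern D w i l = kern D w i i"
  using anc_mono[of l i] assms by (simp add: kern_def subtree_def Int_absorb2)

lemma kern_not_subtree:
  assumes "i \<in> nodes D" "l \<in> nodes D" "l \<notin> subtree i"
  shows "kern D w i l = kern D w (sig D i) l"
  using anc_rec[of i] assms by (simp add: kern_def subtree_def)

end

locale message_passing = radial_network +
  fixes w :: "nat \<Rightarrow> real" and tu td :: "nat \<Rightarrow> nat \<Rightarrow> nat" and \<tau> :: nat
    and lam al ah b bh z :: "nat \<Rightarrow> nat \<Rightarrow> real"
  assumes delay: "\<And>j t. j \<in> nodes D \<Longrightarrow> sig D j \<noteq> 0 \<Longrightarrow> tu j t \<le> \<tau> \<and> td j t \<le> \<tau>"
    and init: "\<And>i. lam 0 i = 0" "\<And>i. al 0 i = 0" "\<And>i. ah 0 i = 0"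
      "\<And>i. b 0 i = 0" "\<And>i. bh 0 i = 0" "\<And>i. z 0 i = 0"
    and al_Suc: "\<And>t i. al (Suc t) i = lam (Suc t) i + (\<Sum>j\<in>children D i. ah t j)"
    and ah_Suc: "\<And>t j. sig D j \<noteq> 0 \<Longrightarrow> ah (Suc t) j = al (Suc t - tu j t) j"
    and b_Suc: "\<And>t j. sig D j \<noteq> 0 \<Longrightarrow> b (Suc t) j =
      kern D w (sig D j) (sig D j) *
        (lam (Suc t) (sig D j) + (\<Sum>r\<in>children D (sig D j) - {j}. ah t r)) + bh t (sig D j)"
    and bh_Suc: "\<And>t j. bh (Suc t) j = (if sig D j \<noteq> 0 then b (Suc t - td j t) j else 0)"
    and z_Suc: "\<And>t i. z (Suc t) i =
      kern D w i i * (lam (Suc t) i + (\<Sum>j\<in>children D i. ah (Suc t) j)) + bh (Suc t) i"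
begin

lemma up_messages_aux:
  assumes al: "\<And>t' c. t' \<le> t \<Longrightarrow> c \<in> nodes D \<Longrightarrow>
      delayed_sum lam t' (subtree c) (\<lambda>_. 1) (\<lambda>l. (\<tau> + 1) * gap c l) (al t' c)"
    and c: "c \<in> nodes D" "sig D c \<noteq> 0"
  shows "delayed_sum lam t (subtree c) (\<lambda>_. 1) (\<lambda>l. (\<tau> + 1) * gap c l + \<tau>) (ah t c)"
proof (cases t)
  case 0
  then show ?thesis using delayed_sum_init[of lam] init by simp
next
  case (Suc s)
  have "delayed_sum lam t (subtree c) (\<lambda>_. 1) (\<lambda>l. (\<tau> + 1) * gap c l + tu c s) (ah t c)"
    using delayed_sum_shift[OF al[of "t - tu c s" c]] c ah_Suc Suc by simp
  then show ?thesis
    by (rule delayed_sum_weaken) (use delay c in auto)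
qed

text \<open>A hop costs up to \<open>\<tau>\<close> for the transmission plus one step because the receiver
  forwards what it had received in the previous iteration.\<close>

lemma subtree_sum:
  assumes ah: "\<And>c. c \<in> children D i \<Longrightarrow>
      delayed_sum lam t (subtree c) (\<lambda>_. 1) (\<lambda>l. (\<tau> + 1) * gap c l + \<tau> + 1) (V c)"
    and C: "C \<subseteq> children D i"
  shows "delayed_sum lam t (insert i (\<Union>c\<in>C. subtree c)) (\<lambda>_. 1) (\<lambda>l. (\<tau> + 1) * gap i l)
    (lam t i + (\<Sum>c\<in>C. V c))"
proof -
  have fin: "finite C" using C finite_subset finite_children by blast
  have "delayed_sum lam t (\<Union>c\<in>C. subtree c) (\<lambda>_. 1) (\<lambda>l. (\<tau> + 1) * gap i l) (\<Sum>c\<in>C. V c)"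
  proof (rule delayed_sum_UN)
    fix c assume "c \<in> C"
    then have c: "c \<in> children D i" using C by auto
    show "delayed_sum lam t (subtree c) (\<lambda>_. 1) (\<lambda>l. (\<tau> + 1) * gap i l) (V c)"
      by (rule delayed_sum_weaken[OF ah[OF c]]) (use gap_descend[OF c] in auto)
  next
    fix c d assume "c \<in> C" "d \<in> C" "c \<noteq> d"
    then show "subtree c \<inter> subtree d = {}" using C by (intro children_subtree_disjoint) auto
  qed (use fin in auto)
  moreover have "i \<notin> (\<Union>c\<in>C. subtree c)" using C not_in_subtree_child by blast
  ultimately have "delayed_sum lam t ({i} \<union> (\<Union>c\<in>C. subtree c)) (\<lambda>_. 1)
      (\<lambda>l. (\<tau> + 1) * gap i l) (lam t i + (\<Sum>c\<in>C. V c))"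
    by (intro delayed_sum_Un delayed_sum_single) (use fin in auto)
  then show ?thesis by simp
qed

lemma up_messages:
  "i \<in> nodes D \<Longrightarrow>
    delayed_sum lam t (subtree i) (\<lambda>_. 1) (\<lambda>l. (\<tau> + 1) * gap i l) (al t i)"
proof (induction t arbitrary: i rule: less_induct)
  case (less t)
  show ?case
  proof (cases t)
    case 0
    then show ?thesis using delayed_sum_init[of lam] init by simp
  next
    case (Suc s)
    have "delayed_sum lam t (subtree c) (\<lambda>_. 1) (\<lambda>l. (\<tau> + 1) * gap c l + \<tau> + 1) (ah s c)"
      if "c \<in> children D i" for c
    proof -
      have "delayed_sum lam (t - 1) (subtree c) (\<lambda>_. 1) (\<lambda>l. (\<tau> + 1) * gap c l + \<tau>) (ah s c)"
        using up_messages_aux[of s c] less.IH that less.prems Suc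
        by (auto simp: children_def nodes_def less_Suc_eq_le)
      then show ?thesis by (rule delayed_sum_shift)
    qed
    from subtree_sum[OF this order_refl]
    show ?thesis using Suc al_Suc subtree_rec[OF less.prems] by simp
  qed
qed

lemma received_up:
  assumes "c \<in> nodes D" "sig D c \<noteq> 0"
  shows "delayed_sum lam t (subtree c) (\<lambda>_. 1) (\<lambda>l. (\<tau> + 1) * gap c l + \<tau>) (ah t c)"
  using up_messages_aux up_messages assms by blast

lemma combine:
  assumes i: "i \<in> nodes D" and C: "C \<subseteq> children D i"
    and ah: "\<And>c. c \<in> children D i \<Longrightarrow>
      delayed_sum lam t (subtree c) (\<lambda>_. 1) (\<lambda>l. (\<tau> + 1) * gap c l + \<tau> + 1) (V c)"
    and bh: "sig D i \<noteq> 0 \<Longrightarrow> delayed_sum lam t (nodes D - subtree i) (kern D w i)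
      (\<lambda>l. (\<tau> + 1) * gap (sig D i) l + \<tau> + 1) U"
    and bh0: "sig D i = 0 \<Longrightarrow> U = 0"
  shows "delayed_sum lam t (insert i (\<Union>c\<in>C. subtree c) \<union> (nodes D - subtree i)) (kern D w i)
    (\<lambda>l. (\<tau> + 1) * gap i l) (kern D w i i * (lam t i + (\<Sum>c\<in>C. V c)) + U)"
proof (rule delayed_sum_Un)
  have sub: "insert i (\<Union>c\<in>C. subtree c) \<subseteq> subtree i"
    using C subtree_rec[OF i] by auto
  show "insert i (\<Union>c\<in>C. subtree c) \<inter> (nodes D - subtree i) = {}" using sub by auto
  show "finite (insert i (\<Union>c\<in>C. subtree c))" using sub finite_subset by fastforce
  show "delayed_sum lam t (insert i (\<Union>c\<in>C. subtree c)) (kern D w i)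
    (\<lambda>l. (\<tau> + 1) * gap i l) (kern D w i i * (lam t i + (\<Sum>c\<in>C. V c)))"
  proof (rule delayed_sum_weaken)
    show "delayed_sum lam t (insert i (\<Union>c\<in>C. subtree c)) (\<lambda>_. kern D w i i * 1)
        (\<lambda>l. (\<tau> + 1) * gap i l) (kern D w i i * (lam t i + (\<Sum>c\<in>C. V c)))"
      by (rule delayed_sum_scale, rule subtree_sum[OF _ C], rule ah)
    show "kern D w i i * 1 = kern D w i l" if "l \<in> insert i (\<Union>c\<in>C. subtree c)" for l
      using sub kern_subtree[OF i, of l] that by auto
  qed auto
  show "delayed_sum lam t (nodes D - subtree i) (kern D w i) (\<lambda>l. (\<tau> + 1) * gap i l) U"
  proof (cases "sig D i = 0")
    case True
    have "kern D w i l = 0" if "l \<in> nodes D - subtree i" for l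
      using kern_not_subtree[OF i] that True by (auto simp: kern_def)
    then show ?thesis using bh0[OF True] by (auto intro: delayed_sum_zero)
  next
    case False
    show ?thesis by (rule delayed_sum_weaken[OF bh[OF False]]) (use gap_ascend[OF i] in auto)
  qed
qed auto

lemma down_messages_aux:
  assumes b: "\<And>t' j. t' \<le> t \<Longrightarrow> j \<in> nodes D \<Longrightarrow> sig D j \<noteq> 0 \<Longrightarrow>
      delayed_sum lam t' (nodes D - subtree j) (kern D w j)
        (\<lambda>l. (\<tau> + 1) * gap (sig D j) l) (b t' j)"
    and c: "c \<in> nodes D" "sig D c \<noteq> 0"
  shows "delayed_sum lam t (nodes D - subtree c) (kern D w c)
        (\<lambda>l. (\<tau> + 1) * gap (sig D c) l + \<tau>) (bh t c)"
proof (cases t)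
  case 0
  then show ?thesis using delayed_sum_init[of lam] init by simp
next
  case (Suc s)
  have "delayed_sum lam t (nodes D - subtree c) (kern D w c)
        (\<lambda>l. (\<tau> + 1) * gap (sig D c) l + td c s) (bh t c)"
    using delayed_sum_shift[OF b[of "t - td c s" c]] c bh_Suc Suc by simp
  then show ?thesis
    by (rule delayed_sum_weaken) (use delay c in auto)
qed

lemma down_messages:
  "j \<in> nodes D \<Longrightarrow> sig D j \<noteq> 0 \<Longrightarrow>
    delayed_sum lam t (nodes D - subtree j) (kern D w j)
      (\<lambda>l. (\<tau> + 1) * gap (sig D j) l) (b t j)"
proof (induction t arbitrary: j rule: less_induct)
  case (less t)
  show ?case
  proof (cases t)
    case 0
    then show ?thesis using delayed_sum_init[of lam] init by simp
  next
    case (Suc s)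
    let ?i = "sig D j"
    have i: "?i \<in> nodes D" using less.prems sig_in_nodes by simp
    have ji: "j \<in> children D ?i" using less.prems by (simp add: children_def)
    let ?S = "insert ?i (\<Union>c\<in>children D ?i - {j}. subtree c) \<union> (nodes D - subtree ?i)"
    have "delayed_sum lam t ?S (kern D w ?i) (\<lambda>l. (\<tau> + 1) * gap ?i l)
      (kern D w ?i ?i * (lam t ?i + (\<Sum>c\<in>children D ?i - {j}. ah s c)) + bh s ?i)"
    proof (rule combine[OF i])
      fix c assume "c \<in> children D ?i"
      then have "delayed_sum lam (t - 1) (subtree c) (\<lambda>_. 1) (\<lambda>l. (\<tau> + 1) * gap c l + \<tau>) (ah s c)"
        using received_up[of c s] i Suc by (auto simp: children_def nodes_def)
      then show "delayed_sum lam t (subtree c) (\<lambda>_. 1)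
        (\<lambda>l. (\<tau> + 1) * gap c l + \<tau> + 1) (ah s c)" by (rule delayed_sum_shift)
    next
      assume "sig D ?i \<noteq> 0"
      then have "delayed_sum lam (t - 1) (nodes D - subtree ?i) (kern D w ?i)
        (\<lambda>l. (\<tau> + 1) * gap (sig D ?i) l + \<tau>) (bh s ?i)"
        using down_messages_aux[of s ?i] less.IH i Suc by (auto simp: less_Suc_eq_le)
      then show "delayed_sum lam t (nodes D - subtree ?i) (kern D w ?i)
        (\<lambda>l. (\<tau> + 1) * gap (sig D ?i) l + \<tau> + 1) (bh s ?i)" by (rule delayed_sum_shift)
    next
      assume "sig D ?i = 0"
      then show "bh s ?i = 0" using bh_Suc init by (cases s) auto
    qed auto
    moreover have "?S = nodes D - subtree j"
    proof -
      let ?A = "\<Union>c\<in>children D ?i - {j}. subtree c"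
      have "subtree ?i = insert ?i (?A \<union> subtree j)"
        using subtree_rec[OF i] ji by blast
      moreover have "?A \<inter> subtree j = {}"
        using children_subtree_disjoint[OF _ ji] by blast
      moreover have "?i \<notin> subtree j" by (rule not_in_subtree_child[OF ji])
      moreover have "subtree ?i \<subseteq> nodes D" by (rule subtree_subset)
      ultimately show ?thesis by blast
    qed
    ultimately have "delayed_sum lam t (nodes D - subtree j) (kern D w ?i)
        (\<lambda>l. (\<tau> + 1) * gap ?i l) (b t j)"
      using b_Suc less.prems Suc by simp
    then show ?thesis
      by (rule delayed_sum_weaken) (use kern_not_subtree less.prems in auto)
  qed
qed

lemma received_down:
  assumes "c \<in> nodes D" "sig D c \<noteq> 0"
  shows "delayed_sum lam t (nodes D - subtree c) (kern D w c)
        (\<lambda>l. (\<tau> + 1) * gap (sig D c) l + \<tau>) (bh t c)"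
  using down_messages_aux down_messages assms by blast

lemma price_delayed_sum:
  assumes i: "i \<in> nodes D"
  shows "delayed_sum lam t (nodes D) (kern D w i) (\<lambda>l. (\<tau> + 1) * gap i l) (z t i)"
proof (cases t)
  case 0
  then show ?thesis using delayed_sum_init[of lam] init by simp
next
  case (Suc s)
  let ?S = "insert i (\<Union>c\<in>children D i. subtree c) \<union> (nodes D - subtree i)"
  have "delayed_sum lam t ?S (kern D w i) (\<lambda>l. (\<tau> + 1) * gap i l)
    (kern D w i i * (lam t i + (\<Sum>c\<in>children D i. ah t c)) + bh t i)"
  proof (rule combine[OF i])
    fix c assume "c \<in> children D i"
    then have "delayed_sum lam t (subtree c) (\<lambda>_. 1) (\<lambda>l. (\<tau> + 1) * gap c l + \<tau>) (ah t c)"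
      using received_up[of c t] i by (auto simp: children_def nodes_def)
    then show "delayed_sum lam t (subtree c) (\<lambda>_. 1)
      (\<lambda>l. (\<tau> + 1) * gap c l + \<tau> + 1) (ah t c)" by (rule delayed_sum_weaken) auto
  next
    assume "sig D i \<noteq> 0"
    then show "delayed_sum lam t (nodes D - subtree i) (kern D w i)
      (\<lambda>l. (\<tau> + 1) * gap (sig D i) l + \<tau> + 1) (bh t i)"
      using received_down[OF i, of t] by (auto elim!: delayed_sum_weaken)
  next
    assume "sig D i = 0"
    then show "bh t i = 0" using bh_Suc Suc by auto
  qed auto
  moreover have "?S = nodes D" using subtree_rec[OF i] subtree_subset i by blast
  ultimately show ?thesis using z_Suc Suc by simp
qed

end

section \<open>Spectral bounds for path-overlap matrices\<close>

definition sqn :: "pdata \<Rightarrow> (nat \<Rightarrow> real) \<Rightarrow> real" where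
  "sqn D v = (\<Sum>i\<in>nodes D. (v i)\<^sup>2)"

lemma sqn_nonneg [simp]: "0 \<le> sqn D v"
  by (simp add: sqn_def sum_nonneg)

lemma vnorm_eq_L2_set: "vnorm D v = L2_set v (nodes D)"
  by (simp add: vnorm_def L2_set_def)

lemma vnorm_sq: "(vnorm D v)\<^sup>2 = sqn D v"
  by (simp add: vnorm_def sqn_def sum_nonneg)

lemma vnorm_nonneg [simp]: "0 \<le> vnorm D v"
  by (simp add: vnorm_eq_L2_set)

lemma sqn_scale: "sqn D (\<lambda>i. c * v i) = c\<^sup>2 * sqn D v"
  by (simp add: sqn_def sum_distrib_left power_mult_distrib)

lemma sqn_abs [simp]: "sqn D (\<lambda>i. \<bar>v i\<bar>) = sqn D v"
  by (simp add: sqn_def)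

lemma abs_le_sqrt_sqn:
  assumes "i \<in> nodes D"
  shows "\<bar>v i\<bar> \<le> sqrt (sqn D v)"
  using member_le_sum[OF assms, of "\<lambda>i. (v i)\<^sup>2"] by (intro real_le_rsqrt) (simp add: sqn_def)

lemma sqn_parallelogram:
  "sqn D (\<lambda>i. x i + y i) + sqn D (\<lambda>i. x i - y i) = 2 * (sqn D x + sqn D y)"
  unfolding sqn_def
  by (simp add: sum.distrib[symmetric] sum_distrib_left power2_eq_square algebra_simps)

lemma mvec_scale: "mvec D A (\<lambda>i. c * v i) = (\<lambda>i. c * mvec D A v i)"
  by (intro ext) (simp add: mvec_def sum_distrib_left ac_simps)

lemma mvec_diff: "mvec D A (\<lambda>i. v i - u i) i = mvec D A v i - mvec D A u i"
  by (simp add: mvec_def sum_subtractf algebra_simps)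

lemma specnorm_bdd: "bdd_above {vnorm D (mvec D A v) |v. vnorm D v \<le> 1}"
proof (rule bdd_aboveI)
  fix y assume "y \<in> {vnorm D (mvec D A v) |v. vnorm D v \<le> 1}"
  then obtain v where v: "y = vnorm D (mvec D A v)" "vnorm D v \<le> 1" by auto
  have "\<bar>v j\<bar> \<le> 1" if "j \<in> nodes D" for j
    using member_le_L2_set[of "nodes D" j "\<lambda>j. \<bar>v j\<bar>"] that v(2)
    unfolding vnorm_eq_L2_set L2_set_def power2_abs by (meson finite_nodes order_trans)
  then have "\<bar>mvec D A v i\<bar> \<le> (\<Sum>j\<in>nodes D. \<bar>A i j\<bar>)" for i
    unfolding mvec_def
    by (intro order_trans[OF sum_abs] sum_mono) (simp add: abs_mult mult_left_le)
  then have "(\<Sum>i\<in>nodes D. \<bar>mvec D A v i\<bar>) \<le> (\<Sum>i\<in>nodes D. \<Sum>j\<in>nodes D. \<bar>A i j\<bar>)"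
    by (intro sum_mono)
  then show "y \<le> (\<Sum>i\<in>nodes D. \<Sum>j\<in>nodes D. \<bar>A i j\<bar>)"
    using L2_set_le_sum_abs[of "mvec D A v" "nodes D"] v by (simp add: vnorm_eq_L2_set)
qed

lemma specnorm_upper: "vnorm D v \<le> 1 \<Longrightarrow> vnorm D (mvec D A v) \<le> specnorm D A"
  unfolding specnorm_def by (rule cSup_upper[OF _ specnorm_bdd]) auto

lemma specnorm_nonneg [simp]: "0 \<le> specnorm D A"
proof -
  have "vnorm D (\<lambda>_. 0) \<le> 1" by (simp add: vnorm_def)
  from specnorm_upper[OF this, of A] show ?thesis
    using vnorm_nonneg order_trans by blast
qed

lemma vnorm_mvec_le: "vnorm D (mvec D A v) \<le> specnorm D A * vnorm D v"
proof (cases "vnorm D v = 0")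
  case True
  then have "\<forall>j\<in>nodes D. v j = 0" by (simp add: vnorm_eq_L2_set L2_set_eq_0_iff)
  then have "mvec D A v = (\<lambda>_. 0)" by (auto simp: mvec_def)
  then show ?thesis using True by (simp add: vnorm_def)
next
  case False
  then have pos: "0 < vnorm D v" using vnorm_nonneg[of D v] by linarith
  have scale: "vnorm D (\<lambda>i. c * u i) = c * vnorm D u" if "0 \<le> c" for c u
    using that by (simp add: vnorm_def sqn_def[symmetric] sqn_scale real_sqrt_mult)
  have "vnorm D (mvec D A (\<lambda>i. inverse (vnorm D v) * v i)) \<le> specnorm D A"
    by (rule specnorm_upper) (use pos in \<open>simp add: scale\<close>)
  then have "inverse (vnorm D v) * vnorm D (mvec D A v) \<le> specnorm D A"
    unfolding mvec_scale using pos by (simp add: scale)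
  then show ?thesis using pos by (simp add: field_simps)
qed

lemma sqn_mvec_le: "sqn D (mvec D A v) \<le> (specnorm D A)\<^sup>2 * sqn D v"
  using power_mono[OF vnorm_mvec_le, of D A v 2] by (simp add: power_mult_distrib vnorm_sq)

lemma quad_form_le_specnorm: "(\<Sum>i\<in>nodes D. x i * mvec D A x i) \<le> specnorm D A * sqn D x"
proof -
  have "(\<Sum>i\<in>nodes D. x i * mvec D A x i) \<le> (\<Sum>i\<in>nodes D. \<bar>x i\<bar> * \<bar>mvec D A x i\<bar>)"
    by (intro sum_mono) (metis abs_ge_self abs_mult)
  also have "\<dots> \<le> vnorm D x * vnorm D (mvec D A x)"
    by (simp add: vnorm_eq_L2_set L2_set_mult_ineq)
  also have "\<dots> \<le> vnorm D x * (specnorm D A * vnorm D x)"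
    by (intro mult_left_mono vnorm_mvec_le) simp
  also have "\<dots> = specnorm D A * sqn D x"
    by (simp add: vnorm_sq[symmetric] power2_eq_square)
  finally show ?thesis .
qed

context radial_network
begin

lemma kern_indicator:
  "kern D w i j = (\<Sum>k\<in>nodes D. 2 * w k * (of_bool (k \<in> anc D i) * of_bool (k \<in> anc D j)))"
  unfolding kern_def sum_distrib_left
  using anc_subset by (intro sum.mono_neutral_cong_left) auto

lemma sum_subtree: "(\<Sum>i\<in>subtree k. f i) = (\<Sum>i\<in>nodes D. of_bool (k \<in> anc D i) * (f i :: real))"
proof -
  have "subtree k = nodes D \<inter> {i. k \<in> anc D i}" by (auto simp: subtree_def)
  then show ?thesis
    by (simp add: sum.inter_restrict)
qed

lemma kern_quad_form:
  "(\<Sum>i\<in>nodes D. x i * mvec D (kern D w) x i) = 2 * (\<Sum>k\<in>nodes D. w k * (\<Sum>i\<in>subtree k. x i)\<^sup>2)"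
proof -
  let ?c = "\<lambda>k i. of_bool (k \<in> anc D i) :: real"
  have "(\<Sum>i\<in>nodes D. x i * mvec D (kern D w) x i)
      = (\<Sum>i\<in>nodes D. \<Sum>j\<in>nodes D. \<Sum>k\<in>nodes D. 2 * w k * ((?c k i * x i) * (?c k j * x j)))"
    unfolding mvec_def kern_indicator
    by (simp add: sum_distrib_left sum_distrib_right ac_simps)
  also have "\<dots> = (\<Sum>i\<in>nodes D. \<Sum>k\<in>nodes D. \<Sum>j\<in>nodes D. 2 * w k * ((?c k i * x i) * (?c k j * x j)))"
    by (intro sum.cong refl sum.swap)
  also have "\<dots> = (\<Sum>k\<in>nodes D. \<Sum>i\<in>nodes D. \<Sum>j\<in>nodes D. 2 * w k * ((?c k i * x i) * (?c k j * x j)))"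
    by (rule sum.swap)
  also have "\<dots> = (\<Sum>k\<in>nodes D. 2 * w k * (\<Sum>i\<in>subtree k. x i)\<^sup>2)"
    unfolding power2_eq_square sum_subtree sum_product by (simp add: sum_distrib_left)
  finally show ?thesis by (simp add: sum_distrib_left mult.assoc)
qed

lemma kern_diag_form:
  "(\<Sum>i\<in>nodes D. kern D w i i * (x i)\<^sup>2) = 2 * (\<Sum>k\<in>nodes D. w k * (\<Sum>i\<in>subtree k. (x i)\<^sup>2))"
proof -
  let ?c = "\<lambda>k i. of_bool (k \<in> anc D i) :: real"
  have "(\<Sum>i\<in>nodes D. kern D w i i * (x i)\<^sup>2)
      = (\<Sum>i\<in>nodes D. \<Sum>k\<in>nodes D. 2 * w k * (?c k i * (x i)\<^sup>2))"
    unfolding kern_indicator sum_distrib_right by (intro sum.cong refl) (simp add: of_bool_def)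
  also have "\<dots> = (\<Sum>k\<in>nodes D. \<Sum>i\<in>nodes D. 2 * w k * (?c k i * (x i)\<^sup>2))" by (rule sum.swap)
  also have "\<dots> = (\<Sum>k\<in>nodes D. 2 * w k * (\<Sum>i\<in>subtree k. (x i)\<^sup>2))"
    by (simp only: sum_subtree sum_distrib_left)
  finally show ?thesis by (simp add: sum_distrib_left mult.assoc)
qed

lemma kern_quad_le_diag:
  assumes "\<And>k. k \<in> nodes D \<Longrightarrow> 0 \<le> w k"
  shows "(\<Sum>i\<in>nodes D. x i * mvec D (kern D w) x i) \<le> real (nN D) * (\<Sum>i\<in>nodes D. kern D w i i * (x i)\<^sup>2)"
proof -
  have "(\<Sum>i\<in>subtree k. x i)\<^sup>2 \<le> real (nN D) * (\<Sum>i\<in>subtree k. (x i)\<^sup>2)" for k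
  proof -
    have "(\<Sum>i\<in>subtree k. x i)\<^sup>2 \<le> (\<Sum>i\<in>subtree k. (x i)\<^sup>2) * real (card (subtree k))"
      by (rule sum_squared_le_sum_of_squares)
    moreover have "card (subtree k) \<le> nN D"
      using card_mono[OF finite_nodes subtree_subset, of k] by (simp add: nodes_def)
    ultimately show ?thesis
      by (smt (verit) mult.commute mult_left_mono of_nat_le_iff sum_nonneg zero_le_power2)
  qed
  then have "(\<Sum>k\<in>nodes D. w k * (\<Sum>i\<in>subtree k. x i)\<^sup>2)
      \<le> (\<Sum>k\<in>nodes D. w k * (real (nN D) * (\<Sum>i\<in>subtree k. (x i)\<^sup>2)))"
    using assms by (intro sum_mono mult_left_mono) auto
  then show ?thesis
    unfolding kern_quad_form kern_diag_form
    by (simp add: sum_distrib_left[symmetric] mult.left_commute[of _ "real (nN D)"])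
qed

end

locale kernel = radial_network +
  fixes w :: "nat \<Rightarrow> real"
  assumes w_nonneg: "\<And>k. k \<in> nodes D \<Longrightarrow> 0 \<le> w k"
begin

abbreviation K where "K \<equiv> kern D w"

definition \<rho> :: real where "\<rho> = specnorm D K"

definition \<kappa> :: real where "\<kappa> = 1 - 1 / real (nN D)"

definition offdiag :: "(nat \<Rightarrow> real) \<Rightarrow> (nat \<Rightarrow> real) \<Rightarrow> real" where
  "offdiag x y = (\<Sum>i\<in>nodes D. \<Sum>j\<in>nodes D - {i}. x i * K i j * y j)"

lemma K_nonneg: "0 \<le> K i j"
  using w_nonneg anc_subset by (auto simp: kern_def intro!: sum_nonneg)

lemma rho_nonneg [simp]: "0 \<le> \<rho>"
  by (simp add: \<rho>_def)

lemma kappa_nonneg [simp]: "0 \<le> \<kappa>"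
  by (cases "nN D = 0") (auto simp: \<kappa>_def)

lemma offdiag_alt:
  "offdiag x x = (\<Sum>i\<in>nodes D. x i * mvec D K x i) - (\<Sum>i\<in>nodes D. K i i * (x i)\<^sup>2)"
proof -
  have "(\<Sum>j\<in>nodes D - {i}. x i * K i j * x j) = x i * mvec D K x i - K i i * (x i)\<^sup>2"
    if "i \<in> nodes D" for i
    using that
    by (simp add: mvec_def sum_distrib_left sum.remove[of "nodes D" i] power2_eq_square algebra_simps)
  then show ?thesis by (simp add: offdiag_def sum_subtractf)
qed

lemma offdiag_self_le: "offdiag x x \<le> \<kappa> * \<rho> * sqn D x"
proof (cases "nN D = 0")
  case True
  then show ?thesis by (simp add: offdiag_def sqn_def nodes_def)
next
  case False
  let ?Q = "\<Sum>i\<in>nodes D. x i * mvec D K x i"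
  have "?Q \<le> real (nN D) * (\<Sum>i\<in>nodes D. K i i * (x i)\<^sup>2)"
    by (rule kern_quad_le_diag) (rule w_nonneg)
  then have "?Q / real (nN D) \<le> (\<Sum>i\<in>nodes D. K i i * (x i)\<^sup>2)"
    using False by (simp add: field_simps)
  then have "offdiag x x \<le> \<kappa> * ?Q"
    unfolding offdiag_alt \<kappa>_def by (simp add: algebra_simps)
  also have "\<dots> \<le> \<kappa> * (\<rho> * sqn D x)"
    unfolding \<rho>_def by (intro mult_left_mono quad_form_le_specnorm) simp
  finally show ?thesis by (simp add: mult.assoc)
qed

lemma offdiag_abs_le: "\<bar>offdiag x x\<bar> \<le> \<kappa> * \<rho> * sqn D x"
proof -
  have "\<bar>offdiag x x\<bar> \<le> offdiag (\<lambda>i. \<bar>x i\<bar>) (\<lambda>i. \<bar>x i\<bar>)"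
    unfolding offdiag_def
    by (intro order_trans[OF sum_abs] sum_mono) (simp add: abs_mult K_nonneg)
  then show ?thesis using offdiag_self_le[of "\<lambda>i. \<bar>x i\<bar>"] by simp
qed

lemma offdiag_commute: "offdiag x y = offdiag y x"
proof -
  have "offdiag x y = (\<Sum>i\<in>nodes D. \<Sum>j\<in>nodes D. if i = j then 0 else x i * K i j * y j)" for x y
    unfolding offdiag_def by (intro sum.cong refl sum.mono_neutral_cong_left) auto
  then show ?thesis
    by (simp add: sum.swap[of "\<lambda>i j. if i = j then 0 else x i * K i j * y j"])
       (auto intro!: sum.cong simp: kern_commute mult_ac)
qed

lemma offdiag_add: "offdiag (\<lambda>i. x i + y i) (\<lambda>i. x i + y i)
    = offdiag x x + offdiag x y + offdiag y x + offdiag y y"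
  unfolding offdiag_def by (simp add: sum.distrib[symmetric] algebra_simps)

lemma offdiag_minus: "offdiag (\<lambda>i. x i - y i) (\<lambda>i. x i - y i)
    = offdiag x x - offdiag x y - offdiag y x + offdiag y y"
  unfolding offdiag_def
  by (simp add: sum.distrib[symmetric] sum_subtractf[symmetric] algebra_simps)

text \<open>Polarisation turns the bound on the quadratic form into one on the bilinear form.\<close>

lemma offdiag_le: "offdiag x y \<le> \<kappa> * \<rho> / 2 * (sqn D x + sqn D y)"
proof -
  have "4 * offdiag x y = offdiag (\<lambda>i. x i + y i) (\<lambda>i. x i + y i) - offdiag (\<lambda>i. x i - y i) (\<lambda>i. x i - y i)"
    unfolding offdiag_add offdiag_minus using offdiag_commute[of x y] by simp
  also have "\<dots> \<le> \<kappa> * \<rho> * (sqn D (\<lambda>i. x i + y i) + sqn D (\<lambda>i. x i - y i))"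
    using offdiag_abs_le[of "\<lambda>i. x i + y i"] offdiag_abs_le[of "\<lambda>i. x i - y i"]
    by (simp add: algebra_simps)
  finally show ?thesis unfolding sqn_parallelogram by (simp add: algebra_simps)
qed

lemma offdiag_scale: "offdiag (\<lambda>i. c * x i) y = c * offdiag x y"
  unfolding offdiag_def by (simp add: sum_distrib_left mult.assoc)

lemma offdiag_response_le:
  "offdiag (\<lambda>i. \<bar>mvec D K u i\<bar>) y \<le> \<kappa> * \<rho>\<^sup>2 / 2 * (sqn D u + sqn D y)"
proof (cases "\<rho> = 0")
  case True
  then have "vnorm D (mvec D K u) = 0"
    using vnorm_mvec_le[of D K u] vnorm_nonneg[of D "mvec D K u"] by (simp add: \<rho>_def)
  then have "\<forall>i\<in>nodes D. mvec D K u i = 0" by (simp add: vnorm_eq_L2_set L2_set_eq_0_iff)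
  then show ?thesis using True by (simp add: offdiag_def)
next
  case False
  then have pos: "0 < \<rho>" using rho_nonneg by linarith
  let ?x = "\<lambda>i. inverse \<rho> * \<bar>mvec D K u i\<bar>"
  have "sqn D ?x = (inverse \<rho>)\<^sup>2 * sqn D (mvec D K u)" unfolding sqn_scale by simp
  also have "\<dots> \<le> (inverse \<rho>)\<^sup>2 * (\<rho>\<^sup>2 * sqn D u)"
    unfolding \<rho>_def by (intro mult_left_mono sqn_mvec_le) simp
  also have "\<dots> = sqn D u" using pos by (simp add: field_simps)
  finally have le: "sqn D ?x \<le> sqn D u" .
  have "offdiag (\<lambda>i. \<bar>mvec D K u i\<bar>) y = \<rho> * offdiag ?x y"
    unfolding offdiag_scale using pos by simp
  also have "\<dots> \<le> \<rho> * (\<kappa> * \<rho> / 2 * (sqn D ?x + sqn D y))"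
    by (intro mult_left_mono offdiag_le) simp
  also have "\<dots> \<le> \<rho> * (\<kappa> * \<rho> / 2 * (sqn D u + sqn D y))"
    using le by (intro mult_left_mono add_right_mono) auto
  finally show ?thesis by (simp add: power2_eq_square ac_simps)
qed

end

lemma two_offdiag_ratio_le_sqrt:
  assumes "0 < n"
  shows "2 * (1 - 1 / real n) \<le> sqrt (real n)"
proof -
  define s where "s = sqrt (real n)"
  have s: "0 < s" "real n = s\<^sup>2" using assms by (auto simp: s_def)
  have "s ^ 3 - 2 * s\<^sup>2 + 2 = (s - 4/3)\<^sup>2 * (s + 2/3) + 22/27"
    by (simp add: power2_eq_square power3_eq_cube field_simps)
  moreover have "0 \<le> (s - 4/3)\<^sup>2 * (s + 2/3)" using s by simp
  ultimately have "2 * s\<^sup>2 - 2 \<le> s ^ 3" by linarith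
  then have "2 * (1 - 1 / s\<^sup>2) \<le> s"
    using s by (simp add: field_simps power3_eq_cube power2_eq_square)
  then show ?thesis by (simp add: s s_def[symmetric])
qed

section \<open>The iteration and its exact counterpart\<close>

lemma clampr_nonexpansive: "\<bar>clampr x l h - clampr y l h\<bar> \<le> \<bar>x - y\<bar>"
  by (auto simp: clampr_def min_def max_def)

lemma clampr_bounds: "l \<le> h \<Longrightarrow> l \<le> clampr x l h \<and> clampr x l h \<le> h"
  by (auto simp: clampr_def)

lemma clampr_response_lipschitz:
  assumes "0 < a"
  shows "\<bar>clampr ((z - b) / a) l h - clampr ((z' - b) / a) l h\<bar> \<le> \<bar>z - z'\<bar> / a"
proof -
  have "(z - b) / a - (z' - b) / a = (z - z') / a" by (simp add: diff_divide_distrib)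
  then show ?thesis
    using clampr_nonexpansive[of "(z - b) / a" l h "(z' - b) / a"] assms by (simp add: abs_divide)
qed

lemma clampr_minimizes:
  fixes a b z x l h :: real
  defines "y \<equiv> clampr ((z - b) / a) l h"
  assumes a: "0 < a" and x: "l \<le> x" "x \<le> h"
  shows "a / 2 * y\<^sup>2 + b * y - z * y + a / 2 * (x - y)\<^sup>2 \<le> a / 2 * x\<^sup>2 + b * x - z * x"
proof -
  define c where "c = (z - b) / a"
  have z: "z = a * c + b" using a by (simp add: c_def)
  have "0 \<le> (y - c) * (x - y)"
    using x unfolding y_def c_def[symmetric] clampr_def
    by (auto simp: min_def max_def mult_nonneg_nonneg mult_nonpos_nonpos)
  then have "0 \<le> a * ((y - c) * (x - y))" using a by simp
  moreover have "(a / 2 * x\<^sup>2 + b * x - z * x)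
      - (a / 2 * y\<^sup>2 + b * y - z * y + a / 2 * (x - y)\<^sup>2) = a * ((y - c) * (x - y))"
    unfolding z by (simp add: power2_eq_square field_simps)
  ultimately show ?thesis by linarith
qed

lemma projected_step_ascent:
  fixes m g c :: real
  assumes "0 \<le> m" "0 < c"
  defines "s \<equiv> max 0 (m + c * g) - m"
  shows "s\<^sup>2 / c \<le> s * g"
proof (cases "0 \<le> m + c * g")
  case True
  then show ?thesis using assms by (simp add: power2_eq_square)
next
  case False
  then have s: "s = - m" by (simp add: s_def)
  have "m * (c * g) \<le> m * (- m)" using False assms by (intro mult_left_mono) auto
  then show ?thesis unfolding s using assms by (simp add: power2_eq_square field_simps)
qed

lemma amgm_completed_square:
  fixes a x y :: real
  assumes "0 < a"
  shows "- x\<^sup>2 / (2 * a) \<le> x * y + a / 2 * y\<^sup>2"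
proof -
  have "x * y + a / 2 * y\<^sup>2 + x\<^sup>2 / (2 * a) = (x + a * y)\<^sup>2 / (2 * a)"
    using assms by (simp add: power2_eq_square field_simps)
  moreover have "0 \<le> (x + a * y)\<^sup>2 / (2 * a)" using assms by simp
  ultimately show ?thesis by linarith
qed

lemma (in kernel) response_ascent:
  assumes a: "0 < a" and W: "finite W"
    and delay_error: "\<And>i. i \<in> nodes D \<Longrightarrow>
      \<bar>p i - pe i\<bar> \<le> (\<Sum>j\<in>nodes D - {i}. K i j * (\<Sum>s\<in>W. \<bar>us s j\<bar>)) / a"
  shows "- \<rho>\<^sup>2 / (2 * a) * sqn D u - \<kappa> * \<rho>\<^sup>2 / (2 * a) * (\<Sum>s\<in>W. sqn D u + sqn D (us s))
    \<le> (\<Sum>i\<in>nodes D. mvec D K u i * (p i - p' i)) + a / 2 * sqn D (\<lambda>i. p' i - pe i)"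
proof -
  let ?g = "mvec D K u"
  have "\<bar>\<Sum>i\<in>nodes D. ?g i * (p i - pe i)\<bar> \<le> (\<Sum>i\<in>nodes D. \<bar>?g i\<bar> * \<bar>p i - pe i\<bar>)"
    by (intro order_trans[OF sum_abs]) (simp add: abs_mult)
  also have "\<dots> \<le> (\<Sum>i\<in>nodes D. \<bar>?g i\<bar> * ((\<Sum>j\<in>nodes D - {i}. K i j * (\<Sum>s\<in>W. \<bar>us s j\<bar>)) / a))"
    by (intro sum_mono mult_left_mono delay_error) auto
  also have "\<dots> = offdiag (\<lambda>i. \<bar>?g i\<bar>) (\<lambda>j. \<Sum>s\<in>W. \<bar>us s j\<bar>) / a"
    by (simp add: offdiag_def sum_divide_distrib sum_distrib_left mult.assoc)
  also have "offdiag (\<lambda>i. \<bar>?g i\<bar>) (\<lambda>j. \<Sum>s\<in>W. \<bar>us s j\<bar>)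
      = (\<Sum>s\<in>W. offdiag (\<lambda>i. \<bar>?g i\<bar>) (\<lambda>j. \<bar>us s j\<bar>))"
    unfolding offdiag_def
    by (simp only: sum_distrib_left sum.swap[of _ W "nodes D"] sum.swap[of _ W "nodes D - {_}"])
  also have "\<dots> / a \<le> (\<Sum>s\<in>W. \<kappa> * \<rho>\<^sup>2 / 2 * (sqn D u + sqn D (us s))) / a"
    using offdiag_response_le[of u "\<lambda>j. \<bar>us _ j\<bar>"] a
    by (intro divide_right_mono sum_mono) auto
  also have "\<dots> = \<kappa> * \<rho>\<^sup>2 / (2 * a) * (\<Sum>s\<in>W. sqn D u + sqn D (us s))"
    by (simp add: sum_distrib_left sum_divide_distrib)
  finally have 1: "- (\<kappa> * \<rho>\<^sup>2 / (2 * a) * (\<Sum>s\<in>W. sqn D u + sqn D (us s)))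
      \<le> (\<Sum>i\<in>nodes D. ?g i * (p i - pe i))" by (simp only: abs_le_iff minus_le_iff)
  have "(\<Sum>i\<in>nodes D. - (?g i)\<^sup>2 / (2 * a))
      \<le> (\<Sum>i\<in>nodes D. ?g i * (pe i - p' i) + a / 2 * (pe i - p' i)\<^sup>2)"
    by (intro sum_mono amgm_completed_square a)
  then have "- sqn D ?g / (2 * a)
      \<le> (\<Sum>i\<in>nodes D. ?g i * (pe i - p' i)) + a / 2 * sqn D (\<lambda>i. p' i - pe i)"
    by (simp add: sqn_def sum.distrib sum_distrib_left sum_divide_distrib sum_negf power2_commute)
  moreover have "sqn D ?g / (2 * a) \<le> \<rho>\<^sup>2 * sqn D u / (2 * a)"
    unfolding \<rho>_def using a by (intro divide_right_mono sqn_mvec_le) simp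
  ultimately have 2: "- (\<rho>\<^sup>2 / (2 * a) * sqn D u)
      \<le> (\<Sum>i\<in>nodes D. ?g i * (pe i - p' i)) + a / 2 * sqn D (\<lambda>i. p' i - pe i)"
    by simp
  have "(\<Sum>i\<in>nodes D. ?g i * (p i - p' i))
      = (\<Sum>i\<in>nodes D. ?g i * (p i - pe i)) + (\<Sum>i\<in>nodes D. ?g i * (pe i - p' i))"
    by (simp add: sum.distrib[symmetric] algebra_simps)
  then show ?thesis using 1 2 by simp
qed

lemma sum_window_le:
  fixes S :: "nat \<Rightarrow> real"
  assumes "\<And>t. 0 \<le> S t"
  shows "(\<Sum>t<T. \<Sum>s\<in>{t - d..<t}. S s) \<le> real d * (\<Sum>t<T. S t)"
proof -
  have "(\<Sum>t<T. \<Sum>s\<in>{t - d..<t}. S s) = (\<Sum>t<T. \<Sum>s<T. if s < t \<and> t \<le> s + d then S s else 0)"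
    by (intro sum.cong refl sum.mono_neutral_cong_left) auto
  also have "\<dots> = (\<Sum>s<T. \<Sum>t<T. if s < t \<and> t \<le> s + d then S s else 0)" by (rule sum.swap)
  also have "\<dots> \<le> (\<Sum>s<T. \<Sum>t\<in>{s<..s + d}. S s)"
  proof (rule sum_mono)
    fix s
    have "(\<Sum>t<T. if s < t \<and> t \<le> s + d then S s else 0) = (\<Sum>t\<in>{..<T} \<inter> {s<..s + d}. S s)"
      by (intro sum.mono_neutral_cong_right) auto
    also have "\<dots> \<le> (\<Sum>t\<in>{s<..s + d}. S s)" by (intro sum_mono2) (auto simp: assms)
    finally show "(\<Sum>t<T. if s < t \<and> t \<le> s + d then S s else 0) \<le> (\<Sum>t\<in>{s<..s + d}. S s)" .
  qed
  finally show ?thesis by (simp add: sum_distrib_left)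
qed

locale dist_opt = radial_network +
  fixes \<gamma> :: real and tu td :: "nat \<Rightarrow> nat \<Rightarrow> nat" and \<tau>max :: nat
  assumes impedance: "\<And>k. k \<in> nodes D \<Longrightarrow> 0 \<le> res D k \<and> 0 \<le> rea D k"
    and boxes: "\<And>i. i \<in> nodes D \<Longrightarrow> plo D i \<le> phi D i \<and> qlo D i \<le> qhi D i"
    and curvature: "\<And>i. i \<in> nodes D \<Longrightarrow> 0 < aP D i \<and> 0 < aQ D i"
    and slater: "slater D"
    and delays: "\<And>j t. j \<in> nodes D \<Longrightarrow> sig D j \<noteq> 0 \<Longrightarrow> tu j t \<le> \<tau>max \<and> td j t \<le> \<tau>max"
    and gamma_pos: "0 < \<gamma>"
    and gamma_small:
      "\<gamma> < 2 / ((1 + ((real \<tau>max + 1) * real (diam D) + 1) * sqrt (real (nN D))) * Lconst D)"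
    and nonempty: "0 < nN D"
begin

sublocale P: kernel D "res D"
  by unfold_locales (simp add: impedance)

sublocale Q: kernel D "rea D"
  by unfold_locales (simp add: impedance)

abbreviation T where "T \<equiv> traj D \<gamma> tu td"
abbreviation lo where "lo t \<equiv> s_lo (T t)"
abbreviation hi where "hi t \<equiv> s_hi (T t)"
abbreviation pt where "pt \<equiv> p_alg D \<gamma> tu td"
abbreviation qt where "qt \<equiv> q_alg D \<gamma> tu td"
abbreviation vt where "vt t \<equiv> volt D (pt t) (qt t)"

definition lam :: "nat \<Rightarrow> nat \<Rightarrow> real" where
  "lam t i = lo t i - hi t i"

lemma hist_eq_traj: "s \<le> t \<Longrightarrow> hist D \<gamma> tu td t s = T s"
proof (induction t)
  case (Suc t)
  then show ?case by (cases "s = Suc t") (auto simp: traj_def)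
qed (simp add: traj_def)

lemma traj_0: "T 0 = st0"
  by (simp add: traj_def)

lemma traj_Suc: "T (Suc t) = step D \<gamma> tu td (hist D \<gamma> tu td t) t"
  by (simp add: traj_def)

text \<open>Messages with a negative time stamp are zero, which is also the initial message, so
  the truncated subtraction gives the right value.\<close>

lemma delayed_eq_traj:
  assumes "f st0 j = 0"
  shows "delayed (hist D \<gamma> tu td t) f (f (T (Suc t)) j) j t k = f (T (Suc t - k)) j"
  using assms by (auto simp: delayed_def hist_eq_traj traj_0)

lemma lo_Suc: "lo (Suc t) i = max 0 (lo t i + \<gamma> * (vlo D i - vt t i))"
  by (simp add: traj_Suc step_def Let_def hist_eq_traj p_alg_def q_alg_def)

lemma hi_Suc: "hi (Suc t) i = max 0 (hi t i + \<gamma> * (vt t i - vhi D i))"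
  by (simp add: traj_Suc step_def Let_def hist_eq_traj p_alg_def q_alg_def)

lemma al_Suc: "s_al (T (Suc t)) i = lam (Suc t) i + (\<Sum>j\<in>children D i. s_ah (T t) j)"
  by (simp add: traj_Suc step_def Let_def hist_eq_traj lam_def)

lemma bP_Suc: "sig D j \<noteq> 0 \<Longrightarrow> s_bP (T (Suc t)) j = Rm D (sig D j) (sig D j) *
    (lam (Suc t) (sig D j) + (\<Sum>r\<in>children D (sig D j) - {j}. s_ah (T t) r)) + s_bhP (T t) (sig D j)"
  by (simp add: traj_Suc step_def Let_def hist_eq_traj lam_def)

lemma bQ_Suc: "sig D j \<noteq> 0 \<Longrightarrow> s_bQ (T (Suc t)) j = Xm D (sig D j) (sig D j) *
    (lam (Suc t) (sig D j) + (\<Sum>r\<in>children D (sig D j) - {j}. s_ah (T t) r)) + s_bhQ (T t) (sig D j)"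
  by (simp add: traj_Suc step_def Let_def hist_eq_traj lam_def)

lemma ah_Suc_new: "s_ah (T (Suc t)) j =
    (if sig D j \<noteq> 0 then delayed (hist D \<gamma> tu td t) s_al (s_al (T (Suc t)) j) j t (tu j t) else 0)"
  unfolding traj_Suc step_def Let_def by simp

lemma bhP_Suc_new: "s_bhP (T (Suc t)) j =
    (if sig D j \<noteq> 0 then delayed (hist D \<gamma> tu td t) s_bP (s_bP (T (Suc t)) j) j t (td j t) else 0)"
  unfolding traj_Suc step_def Let_def by simp

lemma bhQ_Suc_new: "s_bhQ (T (Suc t)) j =
    (if sig D j \<noteq> 0 then delayed (hist D \<gamma> tu td t) s_bQ (s_bQ (T (Suc t)) j) j t (td j t) else 0)"
  unfolding traj_Suc step_def Let_def by simp

lemma ah_Suc: "s_ah (T (Suc t)) j = (if sig D j \<noteq> 0 then s_al (T (Suc t - tu j t)) j else 0)"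
  unfolding ah_Suc_new by (subst delayed_eq_traj) (simp_all add: st0_def)

lemma bhP_Suc: "s_bhP (T (Suc t)) j = (if sig D j \<noteq> 0 then s_bP (T (Suc t - td j t)) j else 0)"
  unfolding bhP_Suc_new by (subst delayed_eq_traj) (simp_all add: st0_def)

lemma bhQ_Suc: "s_bhQ (T (Suc t)) j = (if sig D j \<noteq> 0 then s_bQ (T (Suc t - td j t)) j else 0)"
  unfolding bhQ_Suc_new by (subst delayed_eq_traj) (simp_all add: st0_def)

lemma zP_Suc: "s_zP (T (Suc t)) i =
    Rm D i i * (lam (Suc t) i + (\<Sum>j\<in>children D i. s_ah (T (Suc t)) j)) + s_bhP (T (Suc t)) i"
  unfolding traj_Suc step_def Let_def lam_def by simp

lemma zQ_Suc: "s_zQ (T (Suc t)) i =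
    Xm D i i * (lam (Suc t) i + (\<Sum>j\<in>children D i. s_ah (T (Suc t)) j)) + s_bhQ (T (Suc t)) i"
  unfolding traj_Suc step_def Let_def lam_def by simp

sublocale MP: message_passing D "res D" tu td \<tau>max lam "\<lambda>t. s_al (T t)" "\<lambda>t. s_ah (T t)"
    "\<lambda>t. s_bP (T t)" "\<lambda>t. s_bhP (T t)" "\<lambda>t. s_zP (T t)"
  using delays
  by unfold_locales
    (auto simp: Rm_eq_kern[symmetric] lam_def[of 0] traj_0 st0_def al_Suc ah_Suc bP_Suc bhP_Suc zP_Suc)

sublocale MQ: message_passing D "rea D" tu td \<tau>max lam "\<lambda>t. s_al (T t)" "\<lambda>t. s_ah (T t)"
    "\<lambda>t. s_bQ (T t)" "\<lambda>t. s_bhQ (T t)" "\<lambda>t. s_zQ (T t)"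
  using delays
  by unfold_locales
    (auto simp: Xm_eq_kern[symmetric] lam_def[of 0] traj_0 st0_def al_Suc ah_Suc bQ_Suc bhQ_Suc zQ_Suc)

end

section \<open>Dual ascent under delays\<close>

lemma mvec_symmetric_pairing:
  assumes "\<And>i j. A i j = A j i"
  shows "(\<Sum>i\<in>nodes D. u i * mvec D A x i) = (\<Sum>i\<in>nodes D. mvec D A u i * x i)"
proof -
  have "(\<Sum>i\<in>nodes D. u i * mvec D A x i) = (\<Sum>i\<in>nodes D. \<Sum>j\<in>nodes D. u i * A i j * x j)"
    by (simp add: mvec_def sum_distrib_left mult.assoc)
  also have "\<dots> = (\<Sum>j\<in>nodes D. \<Sum>i\<in>nodes D. u i * A i j * x j)" by (rule sum.swap)
  also have "\<dots> = (\<Sum>j\<in>nodes D. mvec D A u j * x j)"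
    unfolding mvec_def sum_distrib_right
    by (intro sum.cong refl) (metis assms mult.commute)
  finally show ?thesis .
qed

lemma volt_pairing:
  "(\<Sum>i\<in>nodes D. u i * (volt D p q i - volt D p' q' i))
    = (\<Sum>i\<in>nodes D. mvec D (Rm D) u i * (p i - p' i)) + (\<Sum>i\<in>nodes D. mvec D (Xm D) u i * (q i - q' i))"
proof -
  have sym: "Rm D i j = Rm D j i" "Xm D i j = Xm D j i" for i j
    by (simp_all add: Rm_eq_kern Xm_eq_kern kern_commute)
  have "(\<Sum>i\<in>nodes D. u i * (volt D p q i - volt D p' q' i))
    = (\<Sum>i\<in>nodes D. u i * mvec D (Rm D) (\<lambda>i. p i - p' i) i)
      + (\<Sum>i\<in>nodes D. u i * mvec D (Xm D) (\<lambda>i. q i - q' i) i)"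
    unfolding mvec_diff volt_def by (simp add: sum.distrib[symmetric] algebra_simps)
  then show ?thesis
    by (simp only: mvec_symmetric_pairing[of "Rm D", OF sym(1)] mvec_symmetric_pairing[of "Xm D", OF sym(2)])
qed

lemma delayed_sum_error:
  assumes "delayed_sum lam t (nodes D) (A i) B V"
    and "i \<in> nodes D" "B i = 0"
    and "\<And>j. j \<in> nodes D \<Longrightarrow> B j \<le> d" "\<And>j. 0 \<le> A i j"
  shows "\<bar>V - mvec D A (lam t) i\<bar>
    \<le> (\<Sum>j\<in>nodes D - {i}. A i j * (\<Sum>s\<in>{t - d..<t}. \<bar>lam (Suc s) j - lam s j\<bar>))"
proof -
  obtain \<delta> where \<delta>: "\<And>j. j \<in> nodes D \<Longrightarrow> \<delta> j \<le> B j"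
    and V: "V = (\<Sum>j\<in>nodes D. A i j * lam (t - \<delta> j) j)"
    using assms(1) by (auto simp: delayed_sum_def)
  have "\<bar>lam (t - \<delta> j) j - lam t j\<bar> \<le> (\<Sum>s\<in>{t - d..<t}. \<bar>lam (Suc s) j - lam s j\<bar>)"
    if "j \<in> nodes D" for j
  proof -
    have "lam t j - lam (t - \<delta> j) j = (\<Sum>s\<in>{t - \<delta> j..<t}. lam (Suc s) j - lam s j)"
      using sum_Suc_diff'[of "t - \<delta> j" t "\<lambda>s. lam s j"] by simp
    then have "\<bar>lam (t - \<delta> j) j - lam t j\<bar> \<le> (\<Sum>s\<in>{t - \<delta> j..<t}. \<bar>lam (Suc s) j - lam s j\<bar>)"
      by (subst abs_minus_commute) (simp only: sum_abs)
    also have "\<dots> \<le> (\<Sum>s\<in>{t - d..<t}. \<bar>lam (Suc s) j - lam s j\<bar>)"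
    proof (rule sum_mono2)
      have "\<delta> j \<le> d" using \<delta> assms(4) that order_trans by blast
      then show "{t - \<delta> j..<t} \<subseteq> {t - d..<t}" by auto
    qed auto
    finally show ?thesis .
  qed
  then have le: "A i j * \<bar>lam (t - \<delta> j) j - lam t j\<bar>
      \<le> A i j * (\<Sum>s\<in>{t - d..<t}. \<bar>lam (Suc s) j - lam s j\<bar>)" if "j \<in> nodes D" for j
    using that assms(5) by (intro mult_left_mono) auto
  have "V - mvec D A (lam t) i = (\<Sum>j\<in>nodes D. A i j * (lam (t - \<delta> j) j - lam t j))"
    unfolding V mvec_def by (simp add: sum_subtractf algebra_simps)
  also have "\<dots> = (\<Sum>j\<in>nodes D - {i}. A i j * (lam (t - \<delta> j) j - lam t j))"
    using \<delta>[OF assms(2)] assms(2,3) by (simp add: sum.remove[of _ i])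
  finally have "\<bar>V - mvec D A (lam t) i\<bar>
      \<le> (\<Sum>j\<in>nodes D - {i}. \<bar>A i j * (lam (t - \<delta> j) j - lam t j)\<bar>)" by simp
  also have "\<dots> = (\<Sum>j\<in>nodes D - {i}. A i j * \<bar>lam (t - \<delta> j) j - lam t j\<bar>)"
    using assms(5) by (simp add: abs_mult)
  finally show ?thesis using sum_mono[OF le] by (smt (verit) DiffD1 le sum_mono)
qed

context dist_opt
begin

definition inbox :: "(nat \<Rightarrow> real) \<Rightarrow> (nat \<Rightarrow> real) \<Rightarrow> bool" where
  "inbox p q \<longleftrightarrow> (\<forall>i\<in>nodes D. plo D i \<le> p i \<and> p i \<le> phi D i \<and> qlo D i \<le> q i \<and> q i \<le> qhi D i)"

definition lagr where
  "lagr p q l h = cost D p q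
    + (\<Sum>i\<in>nodes D. l i * (vlo D i - volt D p q i) + h i * (volt D p q i - vhi D i))"

lemma amin_le: "i \<in> nodes D \<Longrightarrow> amin D \<le> aP D i \<and> amin D \<le> aQ D i"
  unfolding amin_def by (auto intro!: Min_le)

lemma amin_pos: "0 < amin D"
proof -
  have "nodes D \<noteq> {}" using nonempty by (auto simp: nodes_def)
  then show ?thesis unfolding amin_def using curvature by (subst Min_gr_iff) auto
qed

lemma inbox_response: "inbox (pof D z) (qof D z')"
  unfolding inbox_def pof_def qof_def using boxes clampr_bounds by blast

lemma lagr_affine:
  "lagr p q l' h' = lagr p q l h + (\<Sum>i\<in>nodes D.
     (l' i - l i) * (vlo D i - volt D p q i) + (h' i - h i) * (volt D p q i - vhi D i))"
  unfolding lagr_def by (simp add: sum.distrib[symmetric] algebra_simps)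

lemma lagr_minimizer:
  fixes l h :: "nat \<Rightarrow> real"
  assumes box: "inbox p q"
  defines "m \<equiv> \<lambda>i. l i - h i"
  defines "p' \<equiv> pof D (mvec D (Rm D) m)" and "q' \<equiv> qof D (mvec D (Xm D) m)"
  shows "lagr p' q' l h + amin D / 2 * (sqn D (\<lambda>i. p i - p' i) + sqn D (\<lambda>i. q i - q' i))
    \<le> lagr p q l h"
proof -
  let ?z = "mvec D (Rm D) m" and ?y = "mvec D (Xm D) m"
  let ?f = "\<lambda>p i. aP D i / 2 * (p i)\<^sup>2 + bP D i * p i - ?z i * p i"
  let ?g = "\<lambda>q i. aQ D i / 2 * (q i)\<^sup>2 + bQ D i * q i - ?y i * q i"
  have "lagr p q l h - lagr p' q' l h
      = cost D p q - cost D p' q' - (\<Sum>i\<in>nodes D. m i * (volt D p q i - volt D p' q' i))"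
    unfolding lagr_def m_def
    by (simp add: sum_subtractf[symmetric] sum.distrib[symmetric] algebra_simps)
  also have "\<dots> = (\<Sum>i\<in>nodes D. ?f p i - ?f p' i) + (\<Sum>i\<in>nodes D. ?g q i - ?g q' i)"
    unfolding volt_pairing cost_def
    by (simp add: sum_subtractf sum.distrib algebra_simps)
  finally have eq: "lagr p q l h - lagr p' q' l h
      = (\<Sum>i\<in>nodes D. ?f p i - ?f p' i) + (\<Sum>i\<in>nodes D. ?g q i - ?g q' i)" .
  have "amin D / 2 * (p i - p' i)\<^sup>2 \<le> ?f p i - ?f p' i" if i: "i \<in> nodes D" for i
  proof -
    have "aP D i / 2 * (p i - p' i)\<^sup>2 \<le> ?f p i - ?f p' i"
      using clampr_minimizes[of "aP D i" "plo D i" "p i" "phi D i" "?z i" "bP D i"]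
        curvature[OF i] box i by (simp add: inbox_def p'_def pof_def)
    moreover have "amin D / 2 * (p i - p' i)\<^sup>2 \<le> aP D i / 2 * (p i - p' i)\<^sup>2"
      using amin_le[OF i] by (intro mult_right_mono) auto
    ultimately show ?thesis by linarith
  qed
  then have 1: "amin D / 2 * sqn D (\<lambda>i. p i - p' i) \<le> (\<Sum>i\<in>nodes D. ?f p i - ?f p' i)"
    unfolding sqn_def sum_distrib_left by (rule sum_mono)
  have "amin D / 2 * (q i - q' i)\<^sup>2 \<le> ?g q i - ?g q' i" if i: "i \<in> nodes D" for i
  proof -
    have "aQ D i / 2 * (q i - q' i)\<^sup>2 \<le> ?g q i - ?g q' i"
      using clampr_minimizes[of "aQ D i" "qlo D i" "q i" "qhi D i" "?y i" "bQ D i"]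
        curvature[OF i] box i by (simp add: inbox_def q'_def qof_def)
    moreover have "amin D / 2 * (q i - q' i)\<^sup>2 \<le> aQ D i / 2 * (q i - q' i)\<^sup>2"
      using amin_le[OF i] by (intro mult_right_mono) auto
    ultimately show ?thesis by linarith
  qed
  then have 2: "amin D / 2 * sqn D (\<lambda>i. q i - q' i) \<le> (\<Sum>i\<in>nodes D. ?g q i - ?g q' i)"
    unfolding sqn_def sum_distrib_left by (rule sum_mono)
  show ?thesis using eq 1 2 by (simp add: distrib_left)
qed

text \<open>\<open>pe\<close> and \<open>qe\<close> are the primal responses to the current multipliers, without delay.\<close>

definition pe where "pe t = pof D (mvec D (Rm D) (lam t))"
definition qe where "qe t = qof D (mvec D (Xm D) (lam t))"
definition ut where "ut t i = lam (Suc t) i - lam t i"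
definition dmax where "dmax = (\<tau>max + 1) * diam D"
definition S where
  "S t = sqn D (\<lambda>i. lo (Suc t) i - lo t i) + sqn D (\<lambda>i. hi (Suc t) i - hi t i)"
definition dual where "dual t = lagr (pe t) (qe t) (lo t) (hi t)"

abbreviation L where "L \<equiv> Lconst D"
abbreviation kap where "kap \<equiv> P.\<kappa>"

lemma S_nonneg [simp]: "0 \<le> S t"
  by (simp add: S_def)

lemma multipliers_nonneg: "0 \<le> lo t i" "0 \<le> hi t i"
  by (cases t; simp add: lo_Suc hi_Suc traj_0 st0_def)+

lemma delay_bound: "i \<in> nodes D \<Longrightarrow> j \<in> nodes D \<Longrightarrow> (\<tau>max + 1) * gap i j \<le> dmax"
  unfolding dmax_def by (intro mult_left_mono gap_le_diam) auto

lemma delay_error_P: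
  assumes i: "i \<in> nodes D"
  shows "\<bar>pt t i - pe t i\<bar>
    \<le> (\<Sum>j\<in>nodes D - {i}. kern D (res D) i j * (\<Sum>s\<in>{t - dmax..<t}. \<bar>ut s j\<bar>)) / amin D"
proof -
  let ?E = "\<Sum>j\<in>nodes D - {i}. kern D (res D) i j * (\<Sum>s\<in>{t - dmax..<t}. \<bar>ut s j\<bar>)"
  have "\<bar>s_zP (T t) i - mvec D (Rm D) (lam t) i\<bar> \<le> ?E"
    unfolding Rm_eq_kern ut_def
    by (rule delayed_sum_error[where A = "kern D (res D)" and i = i and d = dmax,
          OF MP.price_delayed_sum[OF i] i])
       (use delay_bound i P.K_nonneg in auto)
  then have "\<bar>s_zP (T t) i - mvec D (Rm D) (lam t) i\<bar> / aP D i \<le> ?E / amin D"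
    using amin_le[OF i] amin_pos by (intro frac_le) auto
  then show ?thesis
    using clampr_response_lipschitz[of "aP D i"] curvature[OF i]
    unfolding p_alg_def pe_def pof_def by (meson order_trans)
qed

lemma delay_error_Q:
  assumes i: "i \<in> nodes D"
  shows "\<bar>qt t i - qe t i\<bar>
    \<le> (\<Sum>j\<in>nodes D - {i}. kern D (rea D) i j * (\<Sum>s\<in>{t - dmax..<t}. \<bar>ut s j\<bar>)) / amin D"
proof -
  let ?E = "\<Sum>j\<in>nodes D - {i}. kern D (rea D) i j * (\<Sum>s\<in>{t - dmax..<t}. \<bar>ut s j\<bar>)"
  have "\<bar>s_zQ (T t) i - mvec D (Xm D) (lam t) i\<bar> \<le> ?E"
    unfolding Xm_eq_kern ut_def
    by (rule delayed_sum_error[where A = "kern D (rea D)" and i = i and d = dmax,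
          OF MQ.price_delayed_sum[OF i] i])
       (use delay_bound i Q.K_nonneg in auto)
  then have "\<bar>s_zQ (T t) i - mvec D (Xm D) (lam t) i\<bar> / aQ D i \<le> ?E / amin D"
    using amin_le[OF i] amin_pos by (intro frac_le) auto
  then show ?thesis
    using clampr_response_lipschitz[of "aQ D i"] curvature[OF i]
    unfolding q_alg_def qe_def qof_def by (meson order_trans)
qed

lemma sqn_ut_le: "sqn D (ut t) \<le> 2 * S t"
proof -
  have "(ut t i)\<^sup>2 \<le> 2 * (lo (Suc t) i - lo t i)\<^sup>2 + 2 * (hi (Suc t) i - hi t i)\<^sup>2" for i
    using sum_squares_ge_zero[of "(lo (Suc t) i - lo t i) + (hi (Suc t) i - hi t i)" 0]
    by (simp add: ut_def lam_def power2_eq_square algebra_simps)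
  then show ?thesis
    unfolding sqn_def S_def sum_distrib_left distrib_left sum.distrib[symmetric]
    by (intro sum_mono) auto
qed

lemma Lconst_eq: "L = 2 * (P.\<rho>\<^sup>2 + Q.\<rho>\<^sup>2) / amin D"
  by (simp add: Lconst_def P.\<rho>_def Q.\<rho>_def Rm_eq_kern Xm_eq_kern)

lemma Lconst_nonneg: "0 \<le> L"
  unfolding Lconst_eq using amin_pos by simp

lemma dual_ascent:
  "dual t + (1 / \<gamma> - L / 2 - kap * L / 2 * dmax) * S t
    - kap * L / 2 * (\<Sum>s\<in>{t - dmax..<t}. S s) \<le> dual (Suc t)"
proof -
  let ?W = "{t - dmax..<t}" and ?a = "amin D"
  let ?v = "vt t" and ?v' = "volt D (pe (Suc t)) (qe (Suc t))"
  let ?dl = "\<lambda>i. lo (Suc t) i - lo t i" and ?dh = "\<lambda>i. hi (Suc t) i - hi t i"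
  have min: "dual t + ?a / 2 * (sqn D (\<lambda>i. pe (Suc t) i - pe t i) + sqn D (\<lambda>i. qe (Suc t) i - qe t i))
      \<le> lagr (pe (Suc t)) (qe (Suc t)) (lo t) (hi t)"
    using lagr_minimizer[of "pe (Suc t)" "qe (Suc t)" "lo t" "hi t"] inbox_response
    by (simp add: dual_def pe_def qe_def lam_def[abs_def])
  have "(\<Sum>i\<in>nodes D. (?dl i)\<^sup>2 / \<gamma> + (?dh i)\<^sup>2 / \<gamma>)
      \<le> (\<Sum>i\<in>nodes D. ?dl i * (vlo D i - ?v i) + ?dh i * (?v i - vhi D i))"
    unfolding lo_Suc hi_Suc
    by (intro sum_mono add_mono projected_step_ascent multipliers_nonneg gamma_pos)
  then have grad: "S t / \<gamma> \<le> (\<Sum>i\<in>nodes D. ?dl i * (vlo D i - ?v i) + ?dh i * (?v i - vhi D i))"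
    by (simp add: S_def sqn_def sum.distrib sum_divide_distrib add_divide_distrib)
  have "dual (Suc t) = lagr (pe (Suc t)) (qe (Suc t)) (lo t) (hi t)
      + (\<Sum>i\<in>nodes D. ?dl i * (vlo D i - ?v' i) + ?dh i * (?v' i - vhi D i))"
    unfolding dual_def by (rule lagr_affine)
  also have "(\<Sum>i\<in>nodes D. ?dl i * (vlo D i - ?v' i) + ?dh i * (?v' i - vhi D i))
      = (\<Sum>i\<in>nodes D. ?dl i * (vlo D i - ?v i) + ?dh i * (?v i - vhi D i))
        + (\<Sum>i\<in>nodes D. ut t i * (?v i - ?v' i))"
    by (simp add: sum.distrib[symmetric] ut_def lam_def algebra_simps)
  finally have dual: "dual (Suc t) = lagr (pe (Suc t)) (qe (Suc t)) (lo t) (hi t)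
      + (\<Sum>i\<in>nodes D. ?dl i * (vlo D i - ?v i) + ?dh i * (?v i - vhi D i))
      + ((\<Sum>i\<in>nodes D. mvec D P.K (ut t) i * (pt t i - pe (Suc t) i))
        + (\<Sum>i\<in>nodes D. mvec D Q.K (ut t) i * (qt t i - qe (Suc t) i)))"
    unfolding volt_pairing Rm_eq_kern Xm_eq_kern by simp
  define U where "U = (\<Sum>s\<in>?W. sqn D (ut t) + sqn D (ut s))"
  have P: "- P.\<rho>\<^sup>2 / (2 * ?a) * sqn D (ut t) - kap * P.\<rho>\<^sup>2 / (2 * ?a) * U
      \<le> (\<Sum>i\<in>nodes D. mvec D P.K (ut t) i * (pt t i - pe (Suc t) i))
        + ?a / 2 * sqn D (\<lambda>i. pe (Suc t) i - pe t i)"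
    unfolding U_def by (rule P.response_ascent[OF amin_pos]) (use delay_error_P in auto)
  have Q: "- Q.\<rho>\<^sup>2 / (2 * ?a) * sqn D (ut t) - kap * Q.\<rho>\<^sup>2 / (2 * ?a) * U
      \<le> (\<Sum>i\<in>nodes D. mvec D Q.K (ut t) i * (qt t i - qe (Suc t) i))
        + ?a / 2 * sqn D (\<lambda>i. qe (Suc t) i - qe t i)"
    unfolding U_def by (rule Q.response_ascent[OF amin_pos]) (use delay_error_Q in auto)
  have PQ: "- P.\<rho>\<^sup>2 / (2 * ?a) * x - kap * P.\<rho>\<^sup>2 / (2 * ?a) * U
      + (- Q.\<rho>\<^sup>2 / (2 * ?a) * x - kap * Q.\<rho>\<^sup>2 / (2 * ?a) * U) = - (L / 4 * x) - kap * L / 4 * U" for x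
    unfolding Lconst_eq using amin_pos by (simp add: field_simps)
  have "U \<le> (\<Sum>s\<in>?W. 2 * S t + 2 * S s)"
    unfolding U_def by (intro sum_mono add_mono sqn_ut_le)
  also have "\<dots> = 2 * (real (card ?W) * S t) + 2 * (\<Sum>s\<in>?W. S s)"
    by (simp add: sum.distrib sum_distrib_left)
  also have "real (card ?W) * S t \<le> real dmax * S t" by (intro mult_right_mono) auto
  finally have "U \<le> 2 * (real dmax * S t) + 2 * (\<Sum>s\<in>?W. S s)" by simp
  then have "kap * L / 4 * U \<le> kap * L / 4 * (2 * (real dmax * S t) + 2 * (\<Sum>s\<in>?W. S s))"
    using Lconst_nonneg by (intro mult_left_mono) auto
  moreover have "L / 4 * sqn D (ut t) \<le> L / 4 * (2 * S t)"
    using Lconst_nonneg sqn_ut_le by (intro mult_left_mono) auto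
  ultimately have "- (L / 2 * S t) - (kap * L / 2 * dmax * S t + kap * L / 2 * (\<Sum>s\<in>?W. S s))
      \<le> - (L / 4 * sqn D (ut t)) - kap * L / 4 * U"
    by (simp add: algebra_simps)
  then show ?thesis using dual min grad P Q PQ[of "sqn D (ut t)"] by (simp add: algebra_simps)
qed

definition margin where "margin = 1 / \<gamma> - L / 2 - kap * L * dmax"

lemma margin_pos: "0 < margin"
proof -
  define X where "X = (1 + ((real \<tau>max + 1) * real (diam D) + 1) * sqrt (real (nN D))) * L"
  have small: "\<gamma> < 2 / X" using gamma_small by (simp add: X_def)
  then have "0 < X" using gamma_pos by (smt (verit) divide_nonneg_nonpos)
  then have L: "0 < L" using Lconst_nonneg by (cases "L = 0") (auto simp: X_def)
  have "X / 2 < 1 / \<gamma>" using small \<open>0 < X\<close> gamma_pos by (simp add: field_simps)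
  moreover have "1 + 2 * kap * dmax \<le> 1 + ((real \<tau>max + 1) * real (diam D) + 1) * sqrt (real (nN D))"
  proof -
    have "2 * kap * dmax \<le> sqrt (real (nN D)) * dmax"
      unfolding P.\<kappa>_def using two_offdiag_ratio_le_sqrt[OF nonempty] by (intro mult_right_mono) auto
    also have "\<dots> \<le> ((real \<tau>max + 1) * real (diam D) + 1) * sqrt (real (nN D))"
      by (simp add: dmax_def algebra_simps)
    finally show ?thesis by simp
  qed
  then have "(1 + 2 * kap * dmax) * L \<le> X" unfolding X_def using L by (intro mult_right_mono) auto
  ultimately show ?thesis unfolding margin_def by (simp add: algebra_simps)
qed

lemma dual_lower: "dual 0 + margin * (\<Sum>t<n. S t) \<le> dual n"
proof -
  let ?c = "kap * L / 2"
  have "dual 0 + (\<Sum>t<n. (margin + ?c * dmax) * S t - ?c * (\<Sum>s\<in>{t - dmax..<t}. S s)) \<le> dual n"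
  proof (induction n)
    case (Suc n)
    have eq: "margin + ?c * dmax = 1 / \<gamma> - L / 2 - ?c * dmax" by (simp add: margin_def)
    have "dual n + ((margin + ?c * dmax) * S n - ?c * (\<Sum>s\<in>{n - dmax..<n}. S s)) \<le> dual (Suc n)"
      unfolding eq using dual_ascent[of n] by linarith
    then show ?case using Suc by simp
  qed simp
  moreover have "(\<Sum>t<n. (margin + ?c * dmax) * S t - ?c * (\<Sum>s\<in>{t - dmax..<t}. S s))
      = (margin + ?c * dmax) * (\<Sum>t<n. S t) - ?c * (\<Sum>t<n. \<Sum>s\<in>{t - dmax..<t}. S s)"
    by (simp only: sum_subtractf sum_distrib_left)
  moreover have "?c * (\<Sum>t<n. \<Sum>s\<in>{t - dmax..<t}. S s) \<le> ?c * (dmax * (\<Sum>t<n. S t))"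
    using Lconst_nonneg by (intro mult_left_mono sum_window_le) auto
  ultimately show ?thesis by (simp add: algebra_simps)
qed

lemma slater_margin:
  obtains p q \<epsilon> where "0 < \<epsilon>" "inbox p q"
    "\<And>i. i \<in> nodes D \<Longrightarrow> vlo D i + \<epsilon> \<le> volt D p q i \<and> volt D p q i + \<epsilon> \<le> vhi D i"
proof -
  obtain p q where pq: "\<And>i. i \<in> nodes D \<Longrightarrow> vlo D i < volt D p q i \<and> volt D p q i < vhi D i \<and>
      plo D i < p i \<and> p i < phi D i \<and> qlo D i < q i \<and> q i < qhi D i"
    using slater by (auto simp: slater_def)
  define A where "A = (\<lambda>i. min (volt D p q i - vlo D i) (vhi D i - volt D p q i)) ` nodes D"
  have A: "finite A" "A \<noteq> {}" using nonempty by (auto simp: A_def nodes_def)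
  show thesis
  proof (rule that[of "Min A" p q])
    show "0 < Min A" using A pq by (subst Min_gr_iff) (auto simp: A_def)
    show "inbox p q" using pq unfolding inbox_def by (meson less_imp_le)
    fix i assume "i \<in> nodes D"
    then have "Min A \<le> min (volt D p q i - vlo D i) (vhi D i - volt D p q i)"
      using A by (intro Min_le) (auto simp: A_def)
    then show "vlo D i + Min A \<le> volt D p q i \<and> volt D p q i + Min A \<le> vhi D i" by auto
  qed
qed

lemma dual_upper:
  assumes "inbox p q"
    and "\<And>i. i \<in> nodes D \<Longrightarrow> vlo D i + \<epsilon> \<le> volt D p q i \<and> volt D p q i + \<epsilon> \<le> vhi D i"
  shows "dual t + \<epsilon> * (\<Sum>i\<in>nodes D. lo t i + hi t i) \<le> cost D p q"
proof -
  have "dual t \<le> lagr p q (lo t) (hi t)"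
    using lagr_minimizer[OF assms(1), of "lo t" "hi t"] amin_pos
    unfolding dual_def pe_def qe_def lam_def[abs_def]
    by (smt (verit) add_nonneg_nonneg divide_nonneg_pos mult_nonneg_nonneg sqn_nonneg)
  moreover have "(\<Sum>i\<in>nodes D. lo t i * (vlo D i - volt D p q i) + hi t i * (volt D p q i - vhi D i))
      \<le> (\<Sum>i\<in>nodes D. lo t i * (- \<epsilon>) + hi t i * (- \<epsilon>))"
    by (intro sum_mono add_mono mult_left_mono multipliers_nonneg) (use assms(2) in force)+
  moreover have "(\<Sum>i\<in>nodes D. lo t i * (- \<epsilon>) + hi t i * (- \<epsilon>))
      = - (\<epsilon> * (\<Sum>i\<in>nodes D. lo t i + hi t i))"
    unfolding sum_distrib_left sum_negf[symmetric] by (intro sum.cong refl) (simp add: algebra_simps)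
  ultimately show ?thesis unfolding lagr_def by linarith
qed

lemma S_tendsto: "S \<longlonglongrightarrow> 0"
proof -
  obtain p q \<epsilon> where pq: "0 < \<epsilon>" "inbox p q"
    "\<And>i. i \<in> nodes D \<Longrightarrow> vlo D i + \<epsilon> \<le> volt D p q i \<and> volt D p q i + \<epsilon> \<le> vhi D i"
    by (rule slater_margin, rule that)
  have "(\<Sum>t<n. S t) \<le> (cost D p q - dual 0) / margin" for n
  proof -
    have "0 \<le> \<epsilon> * (\<Sum>i\<in>nodes D. lo n i + hi n i)"
      using pq(1) multipliers_nonneg by (intro mult_nonneg_nonneg sum_nonneg add_nonneg_nonneg) auto
    then have "margin * (\<Sum>t<n. S t) \<le> cost D p q - dual 0"
      using dual_upper[OF pq(2,3), of n] dual_lower[of n] by linarith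
    then show ?thesis using margin_pos by (simp add: field_simps)
  qed
  then have "summable S" by (intro summableI_nonneg_bounded) auto
  then show ?thesis by (rule summable_LIMSEQ_zero)
qed

lemma multipliers_bounded:
  obtains B where "\<And>t i. i \<in> nodes D \<Longrightarrow> lo t i \<le> B \<and> hi t i \<le> B"
proof -
  obtain p q \<epsilon> where pq: "0 < \<epsilon>" "inbox p q"
    "\<And>i. i \<in> nodes D \<Longrightarrow> vlo D i + \<epsilon> \<le> volt D p q i \<and> volt D p q i + \<epsilon> \<le> vhi D i"
    by (rule slater_margin, rule that)
  show thesis
  proof (rule that)
    fix t i assume i: "i \<in> nodes D"
    have "0 \<le> margin * (\<Sum>t<t. S t)"
      using margin_pos by (intro mult_nonneg_nonneg sum_nonneg) auto
    then have "\<epsilon> * (\<Sum>i\<in>nodes D. lo t i + hi t i) \<le> cost D p q - dual 0"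
      using dual_upper[OF pq(2,3), of t] dual_lower[of t] by linarith
    then have "(\<Sum>i\<in>nodes D. lo t i + hi t i) \<le> (cost D p q - dual 0) / \<epsilon>"
      using pq(1) by (simp add: field_simps)
    moreover have "lo t i + hi t i \<le> (\<Sum>i\<in>nodes D. lo t i + hi t i)"
      using i multipliers_nonneg
      by (intro member_le_sum[of i "nodes D" "\<lambda>i. lo t i + hi t i"]) (auto intro: add_nonneg_nonneg)
    ultimately show "lo t i \<le> (cost D p q - dual 0) / \<epsilon> \<and> hi t i \<le> (cost D p q - dual 0) / \<epsilon>"
      using multipliers_nonneg[of t i] by linarith
  qed
qed

end

section \<open>Convergence to the optimum\<close>

lemma projected_step_slackness:
  fixes m g c :: real
  assumes "0 \<le> m" "m \<le> B" "0 < c" "\<bar>g\<bar> \<le> G"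
  defines "s \<equiv> max 0 (m + c * g) - m"
  shows "\<bar>m * g\<bar> \<le> \<bar>s\<bar> * (B / c + G)"
proof (cases "0 \<le> m + c * g")
  case True
  then have s: "s = c * g" by (simp add: s_def)
  have "\<bar>m * g\<bar> = \<bar>s\<bar> * (m / c)" unfolding s using assms(1,3) by (simp add: abs_mult)
  also have "\<dots> \<le> \<bar>s\<bar> * (B / c + G)"
    using assms by (intro mult_left_mono add_increasing2 divide_right_mono) auto
  finally show ?thesis .
next
  case False
  then have s: "\<bar>s\<bar> = m" using assms by (simp add: s_def)
  have "m * \<bar>g\<bar> \<le> m * (B / c + G)"
    using assms by (intro mult_left_mono add_increasing) auto
  then show ?thesis using s assms(1) by (simp add: abs_mult)
qed

lemma quadratic_convex:
  fixes a b c x y \<theta> :: real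
  assumes "0 \<le> a" "0 \<le> \<theta>" "\<theta> \<le> 1"
  defines "f \<equiv> \<lambda>x. a / 2 * x\<^sup>2 + b * x + c"
  shows "f ((1 - \<theta>) * x + \<theta> * y) \<le> (1 - \<theta>) * f x + \<theta> * f y"
proof -
  have "(1 - \<theta>) * f x + \<theta> * f y - f ((1 - \<theta>) * x + \<theta> * y) = a / 2 * (\<theta> * (1 - \<theta>) * (x - y)\<^sup>2)"
    by (simp add: f_def power2_eq_square field_simps)
  moreover have "0 \<le> a / 2 * (\<theta> * (1 - \<theta>) * (x - y)\<^sup>2)" using assms by simp
  ultimately show ?thesis by linarith
qed

lemma volt_convex_comb:
  "volt D (\<lambda>i. (1 - \<theta>) * p i + \<theta> * p' i) (\<lambda>i. (1 - \<theta>) * q i + \<theta> * q' i) i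
    = (1 - \<theta>) * volt D p q i + \<theta> * volt D p' q' i"
  unfolding volt_def mvec_def
  by (simp add: sum.distrib[symmetric] sum_distrib_left algebra_simps)

lemma mvec_cong: "(\<And>i. i \<in> nodes D \<Longrightarrow> p i = p' i) \<Longrightarrow> mvec D A p = mvec D A p'"
  by (auto simp: mvec_def)

lemma continuous_on_coordinate_fst: "continuous_on A (\<lambda>x :: (nat \<Rightarrow> real) \<times> (nat \<Rightarrow> real). fst x i)"
  using continuous_on_compose2[OF continuous_on_product_coordinates continuous_on_fst[OF continuous_on_id]]
  by auto

lemma continuous_on_coordinate_snd: "continuous_on A (\<lambda>x :: (nat \<Rightarrow> real) \<times> (nat \<Rightarrow> real). snd x i)"
  using continuous_on_compose2[OF continuous_on_product_coordinates continuous_on_snd[OF continuous_on_id]]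
  by auto

lemma compact_box: "compact {f :: nat \<Rightarrow> real. \<forall>i. l i \<le> f i \<and> f i \<le> h i}"
proof -
  have "{f :: nat \<Rightarrow> real. \<forall>i. l i \<le> f i \<and> f i \<le> h i} = PiE UNIV (\<lambda>i. {l i..h i})"
    by (auto simp: PiE_def Pi_def)
  moreover have "compactin (product_topology (\<lambda>_. euclidean) UNIV) (PiE UNIV (\<lambda>i. {l i..h i}))"
    unfolding compactin_PiE by (auto simp: compactin_euclidean_iff)
  ultimately show ?thesis by (simp add: euclidean_product_topology compactin_euclidean_iff)
qed

lemma optimal_exists:
  assumes "feasible D p0 q0"
  shows "\<exists>p q. optimal D p q"
proof -
  define r where "r = (\<lambda>f i. if i \<in> nodes D then f i else (0 :: real))"
  define A where "A = {p. \<forall>i. r (plo D) i \<le> p i \<and> p i \<le> r (phi D) i}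
    \<times> {q. \<forall>i. r (qlo D) i \<le> q i \<and> q i \<le> r (qhi D) i}"
  define F where "F = {x. \<forall>i\<in>nodes D. vlo D i \<le> volt D (fst x) (snd x) i \<and> volt D (fst x) (snd x) i \<le> vhi D i}"
  have volt_r: "volt D (r p) (r q) = volt D p q" for p q
    unfolding volt_def by (auto simp: r_def cong: mvec_cong)
  have cost_r: "cost D (r p) (r q) = cost D p q" for p q
    by (simp add: cost_def r_def)
  have feas: "(r p, r q) \<in> A \<inter> F \<longleftrightarrow> feasible D p q" for p q
  proof -
    have "(r p, r q) \<in> A \<longleftrightarrow> (\<forall>i\<in>nodes D. plo D i \<le> p i \<and> p i \<le> phi D i \<and> qlo D i \<le> q i \<and> q i \<le> qhi D i)"
      by (auto simp: A_def r_def)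
    moreover have "(r p, r q) \<in> F \<longleftrightarrow> (\<forall>i\<in>nodes D. vlo D i \<le> volt D p q i \<and> volt D p q i \<le> vhi D i)"
      by (simp add: F_def volt_r)
    ultimately show ?thesis by (auto simp: feasible_def)
  qed
  have id: "r p = p \<and> r q = q" if "(p, q) \<in> A" for p q
    using that by (auto simp: A_def r_def fun_eq_iff intro: antisym split: if_splits)
  have contv: "continuous_on B (\<lambda>x. volt D (fst x) (snd x) i)" for B i
    unfolding volt_def mvec_def
    by (intro continuous_intros continuous_on_coordinate_fst continuous_on_coordinate_snd)
  have "F = (\<Inter>i\<in>nodes D. {x. vlo D i \<le> volt D (fst x) (snd x) i} \<inter> {x. volt D (fst x) (snd x) i \<le> vhi D i})"
    by (auto simp: F_def)
  then have "closed F"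
    by (auto intro!: closed_INT closed_Int closed_Collect_le contv continuous_on_const)
  then have "compact (A \<inter> F)"
    unfolding A_def by (intro compact_Int_closed compact_Times compact_box)
  moreover have "A \<inter> F \<noteq> {}" using feas[of p0 q0] assms by auto
  moreover have "continuous_on (A \<inter> F) (\<lambda>x. cost D (fst x) (snd x))"
    unfolding cost_def
    by (intro continuous_intros continuous_on_coordinate_fst continuous_on_coordinate_snd)
  ultimately obtain x where x: "x \<in> A \<inter> F"
    "\<And>y. y \<in> A \<inter> F \<Longrightarrow> cost D (fst x) (snd x) \<le> cost D (fst y) (snd y)"
    using continuous_attains_inf by meson
  obtain p q where pq: "x = (p, q)" by (cases x)
  have "feasible D p q" using feas[of p q] id[of p q] x(1) pq by auto
  moreover have "cost D p q \<le> cost D p' q'" if "feasible D p' q'" for p' q'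
    using x(2)[of "(r p', r q')"] feas that cost_r pq by auto
  ultimately show ?thesis by (auto simp: optimal_def)
qed

lemma LIMSEQ_window_sum:
  fixes f :: "nat \<Rightarrow> real"
  assumes "f \<longlonglongrightarrow> 0" and nonneg: "\<And>t. 0 \<le> f t"
  shows "(\<lambda>t. \<Sum>s\<in>{t - d..<t}. f s) \<longlonglongrightarrow> 0"
proof (rule tendsto_sandwich[OF _ _ tendsto_const])
  have "(\<lambda>t. f (t - Suc k)) \<longlonglongrightarrow> 0" for k
    by (rule LIMSEQ_offset[of _ "Suc k"]) (simp add: assms)
  then have "(\<lambda>t. \<Sum>k<d. f (t - Suc k)) \<longlonglongrightarrow> (\<Sum>k<d. 0)" by (intro tendsto_sum)
  then show "(\<lambda>t. \<Sum>k<d. f (t - Suc k)) \<longlonglongrightarrow> 0" by simp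
  have "(\<Sum>s\<in>{t - d..<t}. f s) \<le> (\<Sum>k<d. f (t - Suc k))" for t
  proof -
    have "(\<Sum>s\<in>{t - d..<t}. f s) = (\<Sum>k<min d t. f (t - Suc k))"
      by (rule sum.reindex_bij_witness[of _ "\<lambda>k. t - Suc k" "\<lambda>s. t - Suc s"]) auto
    also have "\<dots> \<le> (\<Sum>k<d. f (t - Suc k))" by (intro sum_mono2) (auto simp: nonneg)
    finally show ?thesis .
  qed
  then show "\<forall>\<^sub>F t in sequentially. (\<Sum>s\<in>{t - d..<t}. f s) \<le> (\<Sum>k<d. f (t - Suc k))" by simp
qed (simp add: sum_nonneg nonneg)

lemma tendsto_zero_le:
  fixes f g :: "nat \<Rightarrow> real"
  assumes "g \<longlonglongrightarrow> 0" "\<And>t. \<bar>f t\<bar> \<le> g t"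
  shows "f \<longlonglongrightarrow> 0"
  using assms by (intro Lim_null_comparison[of f g]) auto

context dist_opt
begin

lemma multiplier_step_tendsto:
  assumes i: "i \<in> nodes D"
  shows "(\<lambda>t. \<bar>lo (Suc t) i - lo t i\<bar>) \<longlonglongrightarrow> 0" "(\<lambda>t. \<bar>hi (Suc t) i - hi t i\<bar>) \<longlonglongrightarrow> 0"
proof -
  have root: "(\<lambda>t. sqrt (S t)) \<longlonglongrightarrow> 0" using tendsto_real_sqrt[OF S_tendsto] by simp
  have "\<bar>lo (Suc t) i - lo t i\<bar> \<le> sqrt (S t)" "\<bar>hi (Suc t) i - hi t i\<bar> \<le> sqrt (S t)" for t
    using abs_le_sqrt_sqn[OF i, of "\<lambda>i. lo (Suc t) i - lo t i"] abs_le_sqrt_sqn[OF i, of "\<lambda>i. hi (Suc t) i - hi t i"]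
    by (auto simp: S_def intro: order_trans real_sqrt_le_mono)
  then show "(\<lambda>t. \<bar>lo (Suc t) i - lo t i\<bar>) \<longlonglongrightarrow> 0" "(\<lambda>t. \<bar>hi (Suc t) i - hi t i\<bar>) \<longlonglongrightarrow> 0"
    by (auto intro: tendsto_zero_le[OF root])
qed

lemma ut_window_tendsto:
  assumes i: "i \<in> nodes D"
  shows "(\<lambda>t. \<Sum>s\<in>{t - dmax..<t}. \<bar>ut s i\<bar>) \<longlonglongrightarrow> 0"
proof (rule LIMSEQ_window_sum)
  have "(\<lambda>t. \<bar>lo (Suc t) i - lo t i\<bar> + \<bar>hi (Suc t) i - hi t i\<bar>) \<longlonglongrightarrow> 0"
    using tendsto_add[OF multiplier_step_tendsto[OF i]] by simp
  then show "(\<lambda>t. \<bar>ut t i\<bar>) \<longlonglongrightarrow> 0"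
    by (rule tendsto_zero_le) (simp add: ut_def lam_def)
qed simp

lemma response_error_tendsto:
  assumes i: "i \<in> nodes D"
  shows "(\<lambda>t. pt t i - pe t i) \<longlonglongrightarrow> 0" "(\<lambda>t. qt t i - qe t i) \<longlonglongrightarrow> 0"
proof -
  have "(\<lambda>t. (\<Sum>j\<in>nodes D - {i}. kern D w i j * (\<Sum>s\<in>{t - dmax..<t}. \<bar>ut s j\<bar>)) / amin D) \<longlonglongrightarrow> 0" for w
    by (intro tendsto_divide_zero tendsto_null_sum tendsto_mult_right_zero ut_window_tendsto) auto
  then show "(\<lambda>t. pt t i - pe t i) \<longlonglongrightarrow> 0" "(\<lambda>t. qt t i - qe t i) \<longlonglongrightarrow> 0"
    using delay_error_P[OF i] delay_error_Q[OF i] by (blast intro: tendsto_zero_le)+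
qed

lemma voltage_error_tendsto: "(\<lambda>t. vt t i - volt D (pe t) (qe t) i) \<longlonglongrightarrow> 0"
proof -
  have "(\<lambda>t. mvec D (Rm D) (\<lambda>j. pt t j - pe t j) i + mvec D (Xm D) (\<lambda>j. qt t j - qe t j) i) \<longlonglongrightarrow> 0"
    unfolding mvec_def
    by (intro tendsto_add_zero tendsto_null_sum tendsto_mult_right_zero response_error_tendsto)
  then show ?thesis by (simp add: volt_def mvec_diff algebra_simps)
qed

lemma voltage_bounded:
  obtains G where "\<And>t. \<bar>vt t i\<bar> \<le> G"
proof -
  let ?p = "\<lambda>j. \<bar>plo D j\<bar> + \<bar>phi D j\<bar>" and ?q = "\<lambda>j. \<bar>qlo D j\<bar> + \<bar>qhi D j\<bar>"
  have mv: "\<bar>mvec D A x i\<bar> \<le> (\<Sum>j\<in>nodes D. \<bar>A i j\<bar> * y j)"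
    if "\<And>j. j \<in> nodes D \<Longrightarrow> \<bar>x j\<bar> \<le> y j" for A x y
    unfolding mvec_def using that
    by (intro order_trans[OF sum_abs] sum_mono) (simp add: abs_mult mult_left_mono)
  have "inbox (pt t) (qt t)" for t unfolding p_alg_def q_alg_def by (rule inbox_response)
  then have "\<bar>pt t j\<bar> \<le> ?p j" "\<bar>qt t j\<bar> \<le> ?q j" if "j \<in> nodes D" for t j
    using that unfolding inbox_def by (smt (verit))+
  then have "\<bar>vt t i\<bar> \<le> (\<Sum>j\<in>nodes D. \<bar>Rm D i j\<bar> * ?p j) + (\<Sum>j\<in>nodes D. \<bar>Xm D i j\<bar> * ?q j) + \<bar>v0 D\<bar>" for t
    unfolding volt_def
    by (intro order_trans[OF abs_triangle_ineq] add_mono order_refl mv)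
  then show thesis by (rule that)
qed

lemma slackness_tendsto:
  assumes i: "i \<in> nodes D"
  shows "(\<lambda>t. lo t i * (vlo D i - volt D (pe t) (qe t) i)) \<longlonglongrightarrow> 0"
    and "(\<lambda>t. hi t i * (volt D (pe t) (qe t) i - vhi D i)) \<longlonglongrightarrow> 0"
proof -
  obtain B where B: "\<And>t i. i \<in> nodes D \<Longrightarrow> lo t i \<le> B \<and> hi t i \<le> B"
    by (rule multipliers_bounded, rule that)
  obtain G where G: "\<And>t. \<bar>vt t i\<bar> \<le> G" by (rule voltage_bounded[of i], rule that)
  let ?ve = "\<lambda>t. volt D (pe t) (qe t) i"
  have err: "(\<lambda>t. B * \<bar>vt t i - ?ve t\<bar>) \<longlonglongrightarrow> 0"
    using voltage_error_tendsto by (intro tendsto_mult_right_zero tendsto_rabs_zero)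
  have 1: "\<bar>lo t i * (vlo D i - ?ve t)\<bar>
      \<le> \<bar>lo (Suc t) i - lo t i\<bar> * (B / \<gamma> + (\<bar>vlo D i\<bar> + G)) + B * \<bar>vt t i - ?ve t\<bar>" for t
  proof -
    have "\<bar>lo t i * (vlo D i - vt t i)\<bar> \<le> \<bar>lo (Suc t) i - lo t i\<bar> * (B / \<gamma> + (\<bar>vlo D i\<bar> + G))"
      unfolding lo_Suc
    proof (rule projected_step_slackness)
      show "\<bar>vlo D i - vt t i\<bar> \<le> \<bar>vlo D i\<bar> + G" using G[of t] by linarith
    qed (use B i multipliers_nonneg gamma_pos in auto)
    moreover have "\<bar>lo t i * (vt t i - ?ve t)\<bar> \<le> B * \<bar>vt t i - ?ve t\<bar>"
      unfolding abs_mult using B[OF i] multipliers_nonneg[of t i] by (intro mult_right_mono) auto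
    moreover have "lo t i * (vlo D i - ?ve t) = lo t i * (vlo D i - vt t i) + lo t i * (vt t i - ?ve t)"
      by (simp add: algebra_simps)
    ultimately show ?thesis by linarith
  qed
  have "(\<lambda>t. \<bar>lo (Suc t) i - lo t i\<bar> * (B / \<gamma> + (\<bar>vlo D i\<bar> + G)) + B * \<bar>vt t i - ?ve t\<bar>) \<longlonglongrightarrow> 0"
    by (intro tendsto_add_zero tendsto_mult_left_zero multiplier_step_tendsto i err)
  then show "(\<lambda>t. lo t i * (vlo D i - ?ve t)) \<longlonglongrightarrow> 0"
    by (rule tendsto_zero_le) (rule 1)
  have 2: "\<bar>hi t i * (?ve t - vhi D i)\<bar>
      \<le> \<bar>hi (Suc t) i - hi t i\<bar> * (B / \<gamma> + (\<bar>vhi D i\<bar> + G)) + B * \<bar>vt t i - ?ve t\<bar>" for t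
  proof -
    have "\<bar>hi t i * (vt t i - vhi D i)\<bar> \<le> \<bar>hi (Suc t) i - hi t i\<bar> * (B / \<gamma> + (\<bar>vhi D i\<bar> + G))"
      unfolding hi_Suc
    proof (rule projected_step_slackness)
      show "\<bar>vt t i - vhi D i\<bar> \<le> \<bar>vhi D i\<bar> + G" using G[of t] by linarith
    qed (use B i multipliers_nonneg gamma_pos in auto)
    moreover have "\<bar>hi t i * (vt t i - ?ve t)\<bar> \<le> B * \<bar>vt t i - ?ve t\<bar>"
      unfolding abs_mult using B[OF i] multipliers_nonneg[of t i] by (intro mult_right_mono) auto
    moreover have "hi t i * (?ve t - vhi D i) = hi t i * (vt t i - vhi D i) - hi t i * (vt t i - ?ve t)"
      by (simp add: algebra_simps)
    ultimately show ?thesis by linarith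
  qed
  have "(\<lambda>t. \<bar>hi (Suc t) i - hi t i\<bar> * (B / \<gamma> + (\<bar>vhi D i\<bar> + G)) + B * \<bar>vt t i - ?ve t\<bar>) \<longlonglongrightarrow> 0"
    by (intro tendsto_add_zero tendsto_mult_left_zero multiplier_step_tendsto i err)
  then show "(\<lambda>t. hi t i * (?ve t - vhi D i)) \<longlonglongrightarrow> 0"
    by (rule tendsto_zero_le) (rule 2)
qed

definition infeas where
  "infeas t = (\<Sum>i\<in>nodes D. max 0 (vlo D i - volt D (pe t) (qe t) i) + max 0 (volt D (pe t) (qe t) i - vhi D i))"

lemma infeas_nonneg: "0 \<le> infeas t"
  unfolding infeas_def by (intro sum_nonneg) auto

lemma violation_le_infeas:
  assumes "i \<in> nodes D"
  shows "vlo D i - volt D (pe t) (qe t) i \<le> infeas t" "volt D (pe t) (qe t) i - vhi D i \<le> infeas t"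
proof -
  have "max 0 (vlo D i - volt D (pe t) (qe t) i) + max 0 (volt D (pe t) (qe t) i - vhi D i) \<le> infeas t"
    unfolding infeas_def using assms by (intro member_le_sum) auto
  then show "vlo D i - volt D (pe t) (qe t) i \<le> infeas t" "volt D (pe t) (qe t) i - vhi D i \<le> infeas t"
    by linarith+
qed

lemma infeas_tendsto: "infeas \<longlonglongrightarrow> 0"
  unfolding infeas_def[abs_def]
proof (intro tendsto_null_sum tendsto_add_zero)
  fix i assume i: "i \<in> nodes D"
  let ?ve = "\<lambda>t. volt D (pe t) (qe t) i"
  have err: "(\<lambda>t. \<bar>vt t i - ?ve t\<bar>) \<longlonglongrightarrow> 0"
    using voltage_error_tendsto by (intro tendsto_rabs_zero)
  have "(\<lambda>t. \<bar>lo (Suc t) i - lo t i\<bar> / \<gamma> + \<bar>vt t i - ?ve t\<bar>) \<longlonglongrightarrow> 0"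
    by (intro tendsto_add_zero tendsto_divide_zero multiplier_step_tendsto i err)
  then show "(\<lambda>t. max 0 (vlo D i - ?ve t)) \<longlonglongrightarrow> 0"
  proof (rule tendsto_zero_le)
    fix t
    have "\<gamma> * (vlo D i - vt t i) \<le> \<bar>lo (Suc t) i - lo t i\<bar>" unfolding lo_Suc by linarith
    then have "vlo D i - vt t i \<le> \<bar>lo (Suc t) i - lo t i\<bar> / \<gamma>"
      using gamma_pos by (simp add: field_simps)
    moreover have "0 \<le> \<bar>lo (Suc t) i - lo t i\<bar> / \<gamma>" using gamma_pos by simp
    ultimately show "\<bar>max 0 (vlo D i - ?ve t)\<bar> \<le> \<bar>lo (Suc t) i - lo t i\<bar> / \<gamma> + \<bar>vt t i - ?ve t\<bar>"
      by linarith
  qed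
  have "(\<lambda>t. \<bar>hi (Suc t) i - hi t i\<bar> / \<gamma> + \<bar>vt t i - ?ve t\<bar>) \<longlonglongrightarrow> 0"
    by (intro tendsto_add_zero tendsto_divide_zero multiplier_step_tendsto i err)
  then show "(\<lambda>t. max 0 (?ve t - vhi D i)) \<longlonglongrightarrow> 0"
  proof (rule tendsto_zero_le)
    fix t
    have "\<gamma> * (vt t i - vhi D i) \<le> \<bar>hi (Suc t) i - hi t i\<bar>" unfolding hi_Suc by linarith
    then have "vt t i - vhi D i \<le> \<bar>hi (Suc t) i - hi t i\<bar> / \<gamma>"
      using gamma_pos by (simp add: field_simps)
    moreover have "0 \<le> \<bar>hi (Suc t) i - hi t i\<bar> / \<gamma>" using gamma_pos by simp
    ultimately show "\<bar>max 0 (?ve t - vhi D i)\<bar> \<le> \<bar>hi (Suc t) i - hi t i\<bar> / \<gamma> + \<bar>vt t i - ?ve t\<bar>"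
      by linarith
  qed
qed

lemma cost_convex:
  assumes "0 \<le> \<theta>" "\<theta> \<le> 1"
  shows "cost D (\<lambda>i. (1 - \<theta>) * p i + \<theta> * p' i) (\<lambda>i. (1 - \<theta>) * q i + \<theta> * q' i)
    \<le> (1 - \<theta>) * cost D p q + \<theta> * cost D p' q'"
proof -
  let ?f = "\<lambda>i x. aP D i / 2 * x\<^sup>2 + bP D i * x + cP D i"
  let ?g = "\<lambda>i x. aQ D i / 2 * x\<^sup>2 + bQ D i * x + cQ D i"
  define F G where "F x = (\<Sum>i\<in>nodes D. ?f i (x i))" and "G x = (\<Sum>i\<in>nodes D. ?g i (x i))" for x
  have cost: "cost D x y = F x + G y" for x y by (simp add: cost_def F_def G_def)
  have "F (\<lambda>i. (1 - \<theta>) * p i + \<theta> * p' i) \<le> (\<Sum>i\<in>nodes D. (1 - \<theta>) * ?f i (p i) + \<theta> * ?f i (p' i))"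
    unfolding F_def
    by (intro sum_mono quadratic_convex) (use curvature assms in \<open>auto intro: less_imp_le\<close>)
  also have "\<dots> = (1 - \<theta>) * F p + \<theta> * F p'" unfolding F_def
    by (subst sum.distrib) (simp only: sum_distrib_left)
  finally have F: "F (\<lambda>i. (1 - \<theta>) * p i + \<theta> * p' i) \<le> (1 - \<theta>) * F p + \<theta> * F p'" .
  have "G (\<lambda>i. (1 - \<theta>) * q i + \<theta> * q' i) \<le> (\<Sum>i\<in>nodes D. (1 - \<theta>) * ?g i (q i) + \<theta> * ?g i (q' i))"
    unfolding G_def
    by (intro sum_mono quadratic_convex) (use curvature assms in \<open>auto intro: less_imp_le\<close>)
  also have "\<dots> = (1 - \<theta>) * G q + \<theta> * G q'" unfolding G_def
    by (subst sum.distrib) (simp only: sum_distrib_left)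
  finally have "G (\<lambda>i. (1 - \<theta>) * q i + \<theta> * q' i) \<le> (1 - \<theta>) * G q + \<theta> * G q'" .
  with F show ?thesis unfolding cost by (simp add: algebra_simps)
qed

text \<open>Mixing in the Slater point with weight \<open>infeas t / (infeas t + \<epsilon>)\<close> repairs feasibility.\<close>

lemma cost_response_lower:
  assumes opt: "optimal D ps qs" and \<epsilon>: "0 < \<epsilon>" and box: "inbox p q"
    and margin: "\<And>i. i \<in> nodes D \<Longrightarrow> vlo D i + \<epsilon> \<le> volt D p q i \<and> volt D p q i + \<epsilon> \<le> vhi D i"
  shows "(infeas t + \<epsilon>) * cost D ps qs \<le> \<epsilon> * cost D (pe t) (qe t) + infeas t * cost D p q"
proof -
  define e where "e = infeas t"
  have e: "0 \<le> e" using infeas_nonneg by (simp add: e_def)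
  define \<theta> where "\<theta> = e / (e + \<epsilon>)"
  have \<theta>: "0 \<le> \<theta>" "\<theta> \<le> 1" "(e + \<epsilon>) * \<theta> = e" "(e + \<epsilon>) * (1 - \<theta>) = \<epsilon>"
    using e \<epsilon> by (auto simp: \<theta>_def field_simps)
  let ?p = "\<lambda>i. (1 - \<theta>) * pe t i + \<theta> * p i" and ?q = "\<lambda>i. (1 - \<theta>) * qe t i + \<theta> * q i"
  have box_e: "inbox (pe t) (qe t)" unfolding pe_def qe_def by (rule inbox_response)
  have ge: "(e + \<epsilon>) * ((1 - \<theta>) * x + \<theta> * y) = \<epsilon> * x + e * y" for x y
    by (simp only: distrib_left mult.assoc[symmetric] \<theta>)
  have convex_le: "c \<le> (1 - \<theta>) * x + \<theta> * y" if "c * (e + \<epsilon>) \<le> \<epsilon> * x + e * y" for c x y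
    using that e \<epsilon> unfolding ge[symmetric] mult.commute[of "e + \<epsilon>"]
    by (simp add: mult_le_cancel_right)
  have convex_ge: "(1 - \<theta>) * x + \<theta> * y \<le> c" if "\<epsilon> * x + e * y \<le> c * (e + \<epsilon>)" for c x y
    using that e \<epsilon> unfolding ge[symmetric] mult.commute[of "e + \<epsilon>"]
    by (simp add: mult_le_cancel_right)
  have mono: "\<epsilon> * x + e * y \<le> \<epsilon> * x' + e * y'" if "x \<le> x'" "y \<le> y'" for x x' y y'
    using that e \<epsilon> by (intro add_mono mult_left_mono) auto
  have "feasible D ?p ?q"
    unfolding feasible_def volt_convex_comb
  proof (intro ballI conjI convex_le convex_ge)
    fix i assume i: "i \<in> nodes D"
    show "vlo D i * (e + \<epsilon>) \<le> \<epsilon> * volt D (pe t) (qe t) i + e * volt D p q i"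
      using mono[of "vlo D i - e" "volt D (pe t) (qe t) i" "vlo D i + \<epsilon>" "volt D p q i"]
        violation_le_infeas(1)[OF i, of t] margin[OF i] by (simp add: e_def algebra_simps)
    show "\<epsilon> * volt D (pe t) (qe t) i + e * volt D p q i \<le> vhi D i * (e + \<epsilon>)"
      using mono[of "volt D (pe t) (qe t) i" "vhi D i + e" "volt D p q i" "vhi D i - \<epsilon>"]
        violation_le_infeas(2)[OF i, of t] margin[OF i] by (simp add: e_def algebra_simps)
    show "plo D i * (e + \<epsilon>) \<le> \<epsilon> * pe t i + e * p i"
      using mono[of "plo D i" "pe t i" "plo D i" "p i"] i box box_e
      by (simp add: inbox_def algebra_simps)
    show "\<epsilon> * pe t i + e * p i \<le> phi D i * (e + \<epsilon>)"
      using mono[of "pe t i" "phi D i" "p i" "phi D i"] i box box_e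
      by (simp add: inbox_def algebra_simps)
    show "qlo D i * (e + \<epsilon>) \<le> \<epsilon> * qe t i + e * q i"
      using mono[of "qlo D i" "qe t i" "qlo D i" "q i"] i box box_e
      by (simp add: inbox_def algebra_simps)
    show "\<epsilon> * qe t i + e * q i \<le> qhi D i * (e + \<epsilon>)"
      using mono[of "qe t i" "qhi D i" "q i" "qhi D i"] i box box_e
      by (simp add: inbox_def algebra_simps)
  qed
  then have "cost D ps qs \<le> cost D ?p ?q" using opt by (simp add: optimal_def)
  also have "\<dots> \<le> (1 - \<theta>) * cost D (pe t) (qe t) + \<theta> * cost D p q"
    by (rule cost_convex[OF \<theta>(1,2)])
  finally have "(e + \<epsilon>) * cost D ps qs \<le> (e + \<epsilon>) * ((1 - \<theta>) * cost D (pe t) (qe t) + \<theta> * cost D p q)"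
    using e \<epsilon> by (intro mult_left_mono) auto
  then show ?thesis unfolding ge by (simp add: e_def)
qed

lemma response_tendsto_optimal:
  assumes opt: "optimal D ps qs"
  shows "(\<lambda>t. sqn D (\<lambda>i. ps i - pe t i) + sqn D (\<lambda>i. qs i - qe t i)) \<longlonglongrightarrow> 0"
proof -
  obtain p q \<epsilon> where pq: "0 < \<epsilon>" "inbox p q"
    "\<And>i. i \<in> nodes D \<Longrightarrow> vlo D i + \<epsilon> \<le> volt D p q i \<and> volt D p q i + \<epsilon> \<le> vhi D i"
    by (rule slater_margin, rule that)
  define C where "C t = (\<Sum>i\<in>nodes D. lo t i * (vlo D i - volt D (pe t) (qe t) i)
      + hi t i * (volt D (pe t) (qe t) i - vhi D i))" for t
  define \<Delta> where "\<Delta> t = sqn D (\<lambda>i. ps i - pe t i) + sqn D (\<lambda>i. qs i - qe t i)" for t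
  define bound where "bound t = infeas t * (cost D p q - cost D ps qs) - \<epsilon> * C t" for t
  have feas: "feasible D ps qs" using opt by (simp add: optimal_def)
  then have box: "inbox ps qs" by (auto simp: feasible_def inbox_def)
  have "\<epsilon> * (amin D / 2 * \<Delta> t) \<le> bound t" for t
  proof -
    have "(\<Sum>i\<in>nodes D. lo t i * (vlo D i - volt D ps qs i) + hi t i * (volt D ps qs i - vhi D i)) \<le> 0"
      using feas multipliers_nonneg
      by (intro sum_nonpos add_nonpos_nonpos mult_nonneg_nonpos) (auto simp: feasible_def)
    then have "lagr ps qs (lo t) (hi t) \<le> cost D ps qs" by (simp add: lagr_def)
    moreover have "lagr (pe t) (qe t) (lo t) (hi t) + amin D / 2 * \<Delta> t \<le> lagr ps qs (lo t) (hi t)"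
      using lagr_minimizer[OF box, of "lo t" "hi t"]
      by (simp add: pe_def qe_def lam_def[abs_def] \<Delta>_def)
    ultimately have "amin D / 2 * \<Delta> t \<le> cost D ps qs - cost D (pe t) (qe t) - C t"
      by (simp add: lagr_def C_def)
    then have "\<epsilon> * (amin D / 2 * \<Delta> t) \<le> \<epsilon> * (cost D ps qs - cost D (pe t) (qe t) - C t)"
      using pq(1) by (intro mult_left_mono) auto
    then show ?thesis
      using cost_response_lower[OF opt pq, of t] by (simp add: bound_def algebra_simps)
  qed
  then have "\<bar>\<Delta> t\<bar> \<le> bound t / (\<epsilon> * (amin D / 2))" for t
    using pq(1) amin_pos by (simp add: \<Delta>_def field_simps)
  moreover have "bound \<longlonglongrightarrow> 0 * (cost D p q - cost D ps qs) - \<epsilon> * 0"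
    unfolding bound_def[abs_def] C_def
    by (intro tendsto_diff tendsto_mult infeas_tendsto tendsto_const tendsto_null_sum
        tendsto_add_zero slackness_tendsto)
  then have "(\<lambda>t. bound t / (\<epsilon> * (amin D / 2))) \<longlonglongrightarrow> 0"
    by (intro tendsto_divide_zero) simp
  ultimately show ?thesis unfolding \<Delta>_def[symmetric] by (rule tendsto_zero_le[rotated])
qed

lemma dist_opt_converges:
  assumes opt: "optimal D ps qs" and i: "i \<in> nodes D"
  shows "(\<lambda>t. pt t i) \<longlonglongrightarrow> ps i" "(\<lambda>t. qt t i) \<longlonglongrightarrow> qs i"
proof -
  let ?\<Delta> = "\<lambda>t. sqn D (\<lambda>i. ps i - pe t i) + sqn D (\<lambda>i. qs i - qe t i)"
  have root: "(\<lambda>t. sqrt (?\<Delta> t)) \<longlonglongrightarrow> 0"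
    using tendsto_real_sqrt[OF response_tendsto_optimal[OF opt]] by simp
  have "\<bar>ps i - pe t i\<bar> \<le> sqrt (?\<Delta> t)" "\<bar>qs i - qe t i\<bar> \<le> sqrt (?\<Delta> t)" for t
    using abs_le_sqrt_sqn[OF i, of "\<lambda>i. ps i - pe t i"] abs_le_sqrt_sqn[OF i, of "\<lambda>i. qs i - qe t i"]
    by (auto intro: order_trans real_sqrt_le_mono)
  then have *: "(\<lambda>t. ps i - pe t i) \<longlonglongrightarrow> 0" "(\<lambda>t. qs i - qe t i) \<longlonglongrightarrow> 0"
    by (auto intro: tendsto_zero_le[OF root])
  show "(\<lambda>t. pt t i) \<longlonglongrightarrow> ps i"
    using tendsto_diff[OF tendsto_const[of "ps i"]
        tendsto_diff[OF *(1) response_error_tendsto(1)[OF i]]] by simp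
  show "(\<lambda>t. qt t i) \<longlonglongrightarrow> qs i"
    using tendsto_diff[OF tendsto_const[of "qs i"]
        tendsto_diff[OF *(2) response_error_tendsto(2)[OF i]]] by simp
qed

end

theorem theorem1:
  fixes D :: pdata and \<gamma> :: real and \<tau>max :: nat
    and tu td :: "nat \<Rightarrow> nat \<Rightarrow> nat"
  assumes "radial D"
    and "\<forall>k\<in>nodes D. res D k \<ge> 0 \<and> rea D k \<ge> 0"
    and "\<forall>i\<in>nodes D. vlo D i \<le> vhi D i \<and> plo D i \<le> phi D i \<and> qlo D i \<le> qhi D i"
    and "\<forall>i\<in>nodes D. aP D i > 0 \<and> aQ D i > 0"
    and "slater D"
    and "\<forall>j\<in>nodes D. sig D j \<noteq> 0 \<longrightarrow> (\<forall>t. tu j t \<le> \<tau>max \<and> td j t \<le> \<tau>max)"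
    and "0 < \<gamma>"
    and "\<gamma> < 2 / ((1 + ((real \<tau>max + 1) * real (diam D) + 1) * sqrt (real (nN D))) * Lconst D)"
  shows "(\<exists>ps qs. optimal D ps qs) \<and>
         (\<forall>ps qs. optimal D ps qs \<longrightarrow>
            (\<forall>i\<in>nodes D. (\<lambda>t. p_alg D \<gamma> tu td t i) \<longlonglongrightarrow> ps i \<and>
                         (\<lambda>t. q_alg D \<gamma> tu td t i) \<longlonglongrightarrow> qs i))"
proof
  obtain p q where "feasible D p q"
    using assms(5) unfolding slater_def feasible_def by (meson less_imp_le)
  then show "\<exists>ps qs. optimal D ps qs" by (rule optimal_exists)
next
  show "\<forall>ps qs. optimal D ps qs \<longrightarrow>
            (\<forall>i\<in>nodes D. (\<lambda>t. p_alg D \<gamma> tu td t i) \<longlonglongrightarrow> ps i \<and>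
                         (\<lambda>t. q_alg D \<gamma> tu td t i) \<longlonglongrightarrow> qs i)"
  proof (intro allI impI ballI)
    fix ps qs i assume opt: "optimal D ps qs" and i: "i \<in> nodes D"
    interpret dist_opt D \<gamma> tu td \<tau>max
      using assms i by unfold_locales (auto simp: nodes_def)
    show "(\<lambda>t. p_alg D \<gamma> tu td t i) \<longlonglongrightarrow> ps i \<and> (\<lambda>t. q_alg D \<gamma> tu td t i) \<longlonglongrightarrow> qs i"
      using dist_opt_converges[OF opt i] by simp
  qed
qed

end
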